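(* Let $\lambda_0,\lambda_1,\mu_0,\mu_1,\varepsilon,\varepsilon'\in\mathbb{R}$ with $\lambda_0,\varepsilon\neq0$ and $r,r'\in\mathbb{Z}$ satisfy $$\lambda_0\varepsilon+\lambda_1r=-\hbar,\quad \mu_0\varepsilon'+\mu_1r'=\hbar',\quad \lambda_0\varepsilon'+\lambda_1r'=0,\quad \mu_0\varepsilon+\mu_1r=0,$$ so that $C^\infty_0(\mathbb{R}\times\mathbb{Z})$ is a $\mathcal{C}_\hbar$-$\mathcal{C}_{\hbar'}$-bimodule with the actions determined by these parameters. Assume that $$(\nabla_u\xi)(x,k)=\frac1{\lambda_0}\frac{d\xi}{dx}(x,k),\qquad(\nabla_v\xi)(x,k)=\frac i\varepsilon\,x\,\xi(x,k)$$ is a bimodule connection on $C^\infty_0(\mathbb{R}\times\mathbb{Z})$. (1) If $\hbar=\hbar'$, then $\hbar=\hbar'=0$. (2) If $\hbar\neq\hbar'$, then $\hbar/\hbar'\in\mathbb{Q}$ and $$\lambda_0=\mu_0=\frac{\hbar r'}{\varepsilon(r-r')},\qquad\lambda_1=-\frac{\hbar}{r-r'},\qquad\mu_1=-\frac{\hbar'}{r-r'},$$ where $\varepsilon=\varepsilon'$ is an arbitrary (nonzero) real number and $r,r'$ are arbitrary (nonzero) integers such that $r/r'=\hbar/\hbar'$. Moreover, $$(\nabla_u\nabla_v\xi)(x,k)-(\nabla_v\nabla_u\xi)(x,k)=i\,\frac{\hbar-\hbar'}{\hbar\hbar'}\,\xi(x,k)$$ for all $\xi\in C^\infty_0(\m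athbb{R}\times\mathbb{Z})$.
   Context: Let $\hbar,\hbar'\in\mathbb{R}$. For real $\hbar$, $\mathcal{C}_\hbar$ is the unital associative $\mathbb{C}$-algebra with generators $U,R,R^{-1},W,W^{-1}$ and relations $WW^{-1}=W^{-1}W=1$, $RR^{-1}=R^{-1}R=1$, $RU=UR$, $R^{-1}U=UR^{-1}$, $WR=e^{\hbar}RW$, $WR^{-1}=e^{-\hbar}R^{-1}W$, $W^{-1}R=e^{-\hbar}RW^{-1}$, $W^{-1}R^{-1}=e^{\hbar}R^{-1}W^{-1}$, $WU=UW+\hbar W$, $W^{-1}U=UW^{-1}-\hbar W^{-1}$; $\mathcal{C}_{\hbar'}$ is the same with $\hbar'$ in place of $\hbar$. On each of these algebras $\partial_u,\partial_v$ are the derivations with $\partial_uU=1$, $\partial_uR=R$, $\partial_uW=0$, $\partial_vU=0$, $\partial_vR=0$, $\partial_vW=iW$. $C^\infty_0(\mathbb{R}\times\mathbb{Z})$ is the space of complex-valued smooth functions on $\mathbb{R}\times\mathbb{Z}$ with compact support (in both variables). The left $\mathcal{C}_\hbar$-action is $(W\xi)(x,k)=\xi(x-\varepsilon,k-r)$, $(R\xi)(x,k)=e^{\lambda_0x+\lambda_1k}\xi(x,k)$, $(U\xi)(x,k)=(\lambda_0x+\lambda_1k)\xi(x,k)$, and the right $\mathcal{C}_{\hbar'}$-action is $(\xi W)(x,k)=\xi(x-\varepsilon',k-r')$, $(\xi R)(x,k)=e^{\mu_0x+\mu_1k}\xi(x,k)$, $(\xi U)(x,k)=(\mu_0x+\mu_1k)\xi(x,k)$,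 with $W^{-1},R^{-1}$ acting by the inverse operators. The pair $(\nabla_u,\nabla_v)$ of linear maps is a bimodule connection if it is both a left and a right connection: for all $\xi$, $\nabla_u(a\xi)=a\nabla_u\xi+(\partial_ua)\xi$ and $\nabla_v(a\xi)=a\nabla_v\xi+(\partial_va)\xi$ for all $a\in\mathcal{C}_\hbar$, and $\nabla_u(\xi a)=(\nabla_u\xi)a+\xi(\partial_ua)$ and $\nabla_v(\xi a)=(\nabla_v\xi)a+\xi(\partial_va)$ for all $a\in\mathcal{C}_{\hbar'}$. In part (2), "arbitrary" means that the displayed formulas, for any such choice of $\varepsilon=\varepsilon'$ and $r,r'$, exhaust the possibilities and $\varepsilon,r,r'$ are free parameters (every such choice satisfies the hypotheses). *)

theory Defs
  imports
    "HOL-Analysis.Analysis"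
    "HOL-Algebra.QuotRing"
    "HOL-Algebra.Module"
    "HOL-Library.Poly_Mapping"
begin

section \<open>The algebras\<close>

text \<open>Lists form the free monoid, so that \<open>'g list \<Rightarrow>\<^sub>0 complex\<close>, with the convolution
  product of \<open>Poly_Mapping\<close>, is the free unital associative complex algebra on \<open>'g\<close>.\<close>

instantiation list :: (type) monoid_add
begin

definition zero_list :: "'a list" where "zero_list = []"

definition plus_list :: "'a list \<Rightarrow> 'a list \<Rightarrow> 'a list" where "plus_list = append"

instance
  by standard (simp_all add: zero_list_def plus_list_def)

end

datatype gen = GU | GR | GRinv | GW | GWinv

type_synonym free_alg = "gen list \<Rightarrow>\<^sub>0 complex"

definition word_elt :: "gen list \<Rightarrow> free_alg"
  where "word_elt w = Poly_Mapping.single w 1"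

definition scalar_elt :: "complex \<Rightarrow> free_alg"
  where "scalar_elt c = Poly_Mapping.single [] c"

definition free_ring :: "free_alg ring"
  where "free_ring = \<lparr>carrier = UNIV, monoid.mult = (*), one = 1, ring.zero = 0, add = (+)\<rparr>"

text \<open>Each relation \<open>p = q\<close> is recorded as the element \<open>p - q\<close>.\<close>

definition relators :: "real \<Rightarrow> free_alg set"
  where "relators h =
   {word_elt [GW, GWinv] - 1,
    word_elt [GWinv, GW] - 1,
    word_elt [GR, GRinv] - 1,
    word_elt [GRinv, GR] - 1,
    word_elt [GR, GU] - word_elt [GU, GR],
    word_elt [GRinv, GU] - word_elt [GU, GRinv],
    word_elt [GW, GR] - scalar_elt (of_real (exp h)) * word_elt [GR, GW],
    word_elt [GW, GRinv] - scalar_elt (of_real (exp (- h))) * word_elt [GRinv, GW],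
    word_elt [GWinv, GR] - scalar_elt (of_real (exp (- h))) * word_elt [GR, GWinv],
    word_elt [GWinv, GRinv] - scalar_elt (of_real (exp h)) * word_elt [GRinv, GWinv],
    word_elt [GW, GU] - (word_elt [GU, GW] + scalar_elt (of_real h) * word_elt [GW]),
    word_elt [GWinv, GU] - (word_elt [GU, GWinv] - scalar_elt (of_real h) * word_elt [GWinv])}"

definition rel_ideal :: "real \<Rightarrow> free_alg set"
  where "rel_ideal h = Idl\<^bsub>free_ring\<^esub> (relators h)"

definition cls :: "real \<Rightarrow> free_alg \<Rightarrow> free_alg set"
  where "cls h p = rel_ideal h +>\<^bsub>free_ring\<^esub> p"

text \<open>The record \<open>module\<close> only serves to add a scalar multiplication to the quotient ring; the
  locale of the same name is not applicable, as it is about commutative rings of scalars acting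
  on a group, and \<open>algebra\<close> is restricted to commutative algebras.\<close>

definition C_alg :: "real \<Rightarrow> (complex, free_alg set) module"
  where "C_alg h = ring.extend (free_ring Quot rel_ideal h)
    (module.fields (\<lambda>c A. cls h (scalar_elt c) \<otimes>\<^bsub>free_ring Quot rel_ideal h\<^esub> A))"

definition derivation :: "(complex, 'a) module \<Rightarrow> ('a \<Rightarrow> 'a) \<Rightarrow> bool"
  where "derivation A D \<longleftrightarrow>
    D \<in> carrier A \<rightarrow> carrier A \<and>
    (\<forall>a\<in>carrier A. \<forall>b\<in>carrier A. D (a \<oplus>\<^bsub>A\<^esub> b) = D a \<oplus>\<^bsub>A\<^esub> D b) \<and>
    (\<forall>c. \<forall>a\<in>carrier A. D (c \<odot>\<^bsub>A\<^esub> a) = c \<odot>\<^bsub>A\<^esub> D a) \<and>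
    (\<forall>a\<in>carrier A. \<forall>b\<in>carrier A.
      D (a \<otimes>\<^bsub>A\<^esub> b) = (D a \<otimes>\<^bsub>A\<^esub> b) \<oplus>\<^bsub>A\<^esub> (a \<otimes>\<^bsub>A\<^esub> D b))"

definition is_partial_u :: "real \<Rightarrow> (free_alg set \<Rightarrow> free_alg set) \<Rightarrow> bool"
  where "is_partial_u h D \<longleftrightarrow> D \<in> extensional (carrier (C_alg h)) \<and> derivation (C_alg h) D \<and>
    D (cls h (word_elt [GU])) = \<one>\<^bsub>C_alg h\<^esub> \<and>
    D (cls h (word_elt [GR])) = cls h (word_elt [GR]) \<and>
    D (cls h (word_elt [GW])) = \<zero>\<^bsub>C_alg h\<^esub>"

definition is_partial_v :: "real \<Rightarrow> (free_alg set \<Rightarrow> free_alg set) \<Rightarrow> bool"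
  where "is_partial_v h D \<longleftrightarrow> D \<in> extensional (carrier (C_alg h)) \<and> derivation (C_alg h) D \<and>
    D (cls h (word_elt [GU])) = \<zero>\<^bsub>C_alg h\<^esub> \<and>
    D (cls h (word_elt [GR])) = \<zero>\<^bsub>C_alg h\<^esub> \<and>
    D (cls h (word_elt [GW])) = \<i> \<odot>\<^bsub>C_alg h\<^esub> cls h (word_elt [GW])"

definition partial_u :: "real \<Rightarrow> free_alg set \<Rightarrow> free_alg set"
  where "partial_u h = (THE D. is_partial_u h D)"

definition partial_v :: "real \<Rightarrow> free_alg set \<Rightarrow> free_alg set"
  where "partial_v h = (THE D. is_partial_v h D)"


subsection \<open>Existence and uniqueness of the derivations\<close>

lemma ring_free_ring: "ring free_ring"
proof -
  have "\<exists>y. y + x = 0 \<and> x + y = 0" for x :: free_alg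
    by (rule exI[of _ "- x"]) simp
  then show ?thesis
    unfolding free_ring_def by unfold_locales (auto simp: algebra_simps Units_def)
qed

lemma ideal_rel_ideal: "ideal (rel_ideal h) free_ring"
  unfolding rel_ideal_def
  by (rule ring.genideal_ideal[OF ring_free_ring]) (simp add: free_ring_def)

lemma rel_idealD:
  assumes "p \<in> rel_ideal h"
    and rel: "\<And>q. q \<in> relators h \<Longrightarrow> P q"
    and zero: "P 0"
    and add: "\<And>p q. P p \<Longrightarrow> P q \<Longrightarrow> P (p + q)"
    and mul: "\<And>p q. P p \<Longrightarrow> P (q * p)" "\<And>p q. P p \<Longrightarrow> P (p * q)"
  shows "P p"
proof -
  have neg: "P (- q)" if "P q" for q
    using mul(1)[OF that, of "- 1"] by simp
  interpret F: ring free_ring by (rule ring_free_ring)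
  have inv_add: "\<ominus>\<^bsub>free_ring\<^esub> x = - x" for x
  proof (rule F.minus_equality)
    show "- x \<oplus>\<^bsub>free_ring\<^esub> x = \<zero>\<^bsub>free_ring\<^esub>" by (simp add: free_ring_def)
  qed (simp_all add: free_ring_def)
  have "ideal {q. P q} free_ring"
  proof (rule idealI[OF ring_free_ring])
    show "subgroup {q. P q} (add_monoid free_ring)"
    proof (rule group.subgroupI)
      show "Group.group (add_monoid free_ring)"
        using F.is_abelian_group abelian_group.a_group by blast
      show "inv\<^bsub>add_monoid free_ring\<^esub> a \<in> {q. P q}" if "a \<in> {q. P q}" for a
        using inv_add[of a] neg that by (simp add: a_inv_def)
    qed (use zero add in \<open>auto simp: free_ring_def\<close>)
  qed (use mul in \<open>auto simp: free_ring_def\<close>)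
  then have "rel_ideal h \<subseteq> {q. P q}"
    unfolding rel_ideal_def by (rule F.genideal_minimal) (use rel in auto)
  with assms(1) show ?thesis by auto
qed

lemma rel_ideal_closed:
  shows "q \<in> relators h \<Longrightarrow> q \<in> rel_ideal h"
    and "0 \<in> rel_ideal h"
    and "p \<in> rel_ideal h \<Longrightarrow> q \<in> rel_ideal h \<Longrightarrow> p + q \<in> rel_ideal h"
    and "p \<in> rel_ideal h \<Longrightarrow> q * p \<in> rel_ideal h"
    and "p \<in> rel_ideal h \<Longrightarrow> p * q \<in> rel_ideal h"
    and "p \<in> rel_ideal h \<Longrightarrow> - p \<in> rel_ideal h"
    and "p \<in> rel_ideal h \<Longrightarrow> q \<in> rel_ideal h \<Longrightarrow> p - q \<in> rel_ideal h"
proof -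
  interpret I: ideal "rel_ideal h" free_ring by (rule ideal_rel_ideal)
  show "q \<in> relators h \<Longrightarrow> q \<in> rel_ideal h"
    unfolding rel_ideal_def
    using ring.genideal_self[OF ring_free_ring, of "relators h"] by (auto simp: free_ring_def)
  show "0 \<in> rel_ideal h"
    using additive_subgroup.zero_closed[OF I.is_additive_subgroup] by (simp add: free_ring_def)
  show add: "p + q \<in> rel_ideal h" if "p \<in> rel_ideal h" "q \<in> rel_ideal h" for p q
    using additive_subgroup.a_closed[OF I.is_additive_subgroup that] by (simp add: free_ring_def)
  show mul: "q * p \<in> rel_ideal h" if "p \<in> rel_ideal h" for p q
    using I.I_l_closed[OF that, of q] by (simp add: free_ring_def)
  show "p * q \<in> rel_ideal h" if "p \<in> rel_ideal h" for p q
    using I.I_r_closed[OF that, of q] by (simp add: free_ring_def)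
  show neg: "- p \<in> rel_ideal h" if "p \<in> rel_ideal h" for p
    using mul[OF that, of "- 1"] by simp
  show "p - q \<in> rel_ideal h" if "p \<in> rel_ideal h" "q \<in> rel_ideal h" for p q
    using add[OF that(1) neg[OF that(2)]] by simp
qed

lemma mem_cls: "q \<in> cls h p \<longleftrightarrow> q - p \<in> rel_ideal h"
proof -
  have "q \<in> cls h p \<longleftrightarrow> (\<exists>i\<in>rel_ideal h. q = i + p)"
    unfolding cls_def a_r_coset_def r_coset_def by (auto simp: free_ring_def)
  also have "\<dots> \<longleftrightarrow> q - p \<in> rel_ideal h"
    by (auto intro!: bexI[of _ "q - p"])
  finally show ?thesis .
qed

lemma cls_eq: "cls h p = cls h q \<longleftrightarrow> p - q \<in> rel_ideal h"
proof
  assume "cls h p = cls h q"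
  then have "p \<in> cls h q"
    using mem_cls[of p h p] rel_ideal_closed(2) by simp
  then show "p - q \<in> rel_ideal h" by (simp add: mem_cls)
next
  assume pq: "p - q \<in> rel_ideal h"
  have "x - p \<in> rel_ideal h \<longleftrightarrow> x - q \<in> rel_ideal h" for x
    using rel_ideal_closed(3)[OF _ pq, of "x - p"] rel_ideal_closed(7)[OF _ pq, of "x - q"]
    by auto
  then show "cls h p = cls h q" by (auto simp: mem_cls)
qed

lemma C_alg_simps:
  shows "carrier (C_alg h) = range (cls h)"
    and "\<one>\<^bsub>C_alg h\<^esub> = cls h 1"
    and "\<zero>\<^bsub>C_alg h\<^esub> = cls h 0"
    and "cls h p \<otimes>\<^bsub>C_alg h\<^esub> cls h q = cls h (p * q)"
    and "cls h p \<oplus>\<^bsub>C_alg h\<^esub> cls h q = cls h (p + q)"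
    and "c \<odot>\<^bsub>C_alg h\<^esub> cls h p = cls h (scalar_elt c * p)"
proof -
  interpret I: ideal "rel_ideal h" free_ring by (rule ideal_rel_ideal)
  have mult: "cls h p \<otimes>\<^bsub>free_ring Quot rel_ideal h\<^esub> cls h q = cls h (p * q)" for p q
    using I.rcoset_mult_add[of p q] by (simp add: FactRing_def cls_def free_ring_def)
  have "rel_ideal h = cls h 0" by (auto simp: mem_cls)
  then show "\<zero>\<^bsub>C_alg h\<^esub> = cls h 0"
    by (simp add: C_alg_def ring.defs module.defs FactRing_def)
  show "carrier (C_alg h) = range (cls h)"
    by (auto simp: C_alg_def ring.defs module.defs FactRing_def A_RCOSETS_def RCOSETS_def
        cls_def a_r_coset_def free_ring_def)
  show "\<one>\<^bsub>C_alg h\<^esub> = cls h 1"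
    by (simp add: C_alg_def ring.defs module.defs FactRing_def cls_def free_ring_def)
  show "cls h p \<otimes>\<^bsub>C_alg h\<^esub> cls h q = cls h (p * q)" for p q
    using mult[of p q] by (simp add: C_alg_def ring.defs module.defs)
  show "c \<odot>\<^bsub>C_alg h\<^esub> cls h p = cls h (scalar_elt c * p)"
    using mult by (simp add: C_alg_def ring.defs module.defs)
  show "cls h p \<oplus>\<^bsub>C_alg h\<^esub> cls h q = cls h (p + q)"
    using I.a_rcos_sum[of p q]
    by (simp add: C_alg_def ring.defs module.defs FactRing_def cls_def free_ring_def)
qed

lemma free_alg_induct [case_names single add]:
  fixes p :: free_alg
  assumes "\<And>w c. P (Poly_Mapping.single w c)"
    and "\<And>p q. P p \<Longrightarrow> P q \<Longrightarrow> P (p + q)"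
  shows "P p"
proof (induction p rule: Poly_Mapping.update_induct)
  case const
  then show ?case using assms(1)[of "[]" 0] by simp
next
  case (update f a b)
  then have "Poly_Mapping.update a b f = f + Poly_Mapping.single a b"
    by (intro poly_mapping_eqI)
      (auto simp: lookup_update lookup_add lookup_single when_def in_keys_iff)
  with update assms show ?case by simp
qed

lemma single_eq: "Poly_Mapping.single w c = scalar_elt c * word_elt w"
  by (simp add: scalar_elt_def word_elt_def mult_single plus_list_def)

lemma word_elt_append: "word_elt (v @ w) = word_elt v * word_elt w"
  by (simp add: word_elt_def mult_single plus_list_def)

lemma word_elt_Cons: "word_elt (g # w) = word_elt [g] * word_elt w"
  using word_elt_append[of "[g]" w] by simp

lemma word_elt_Nil: "word_elt [] = 1" and scalar_elt_1: "scalar_elt 1 = 1"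
  by (simp_all add: word_elt_def scalar_elt_def zero_list_def flip: single_one)

lemma scalar_elt_mult: "scalar_elt (c * d) = scalar_elt c * scalar_elt d"
  by (simp add: scalar_elt_def mult_single plus_list_def)

lemma scalar_elt_comm: "p * scalar_elt c = scalar_elt c * p"
  by (induction p rule: free_alg_induct)
    (simp_all add: scalar_elt_def mult_single plus_list_def algebra_simps)

lemma scalar_elt_add: "scalar_elt (c + d) = scalar_elt c + scalar_elt d"
  by (simp add: scalar_elt_def single_add)

lemma scalar_elt_0: "scalar_elt 0 = 0"
  by (simp add: scalar_elt_def)

lemma scalar_elt_minus: "scalar_elt (- c) = - scalar_elt c"
  by (simp add: scalar_elt_def single_uminus)

fun word_der :: "(gen \<Rightarrow> free_alg) \<Rightarrow> gen list \<Rightarrow> free_alg"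
  where
    "word_der d [] = 0"
  | "word_der d (g # w) = d g * word_elt w + word_elt [g] * word_der d w"

definition free_der :: "(gen \<Rightarrow> free_alg) \<Rightarrow> free_alg \<Rightarrow> free_alg"
  where "free_der d p =
    (\<Sum>w\<in>Poly_Mapping.keys p. scalar_elt (Poly_Mapping.lookup p w) * word_der d w)"

lemma free_der_superset:
  assumes "finite S" "Poly_Mapping.keys p \<subseteq> S"
  shows "free_der d p = (\<Sum>w\<in>S. scalar_elt (Poly_Mapping.lookup p w) * word_der d w)"
  unfolding free_der_def using assms
  by (intro sum.mono_neutral_left) (auto simp: in_keys_iff scalar_elt_0)

lemma free_der_single: "free_der d (Poly_Mapping.single w c) = scalar_elt c * word_der d w"
  using free_der_superset[of "{w}" "Poly_Mapping.single w c" d] by (simp add: lookup_single)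

lemma free_der_add: "free_der d (p + q) = free_der d p + free_der d q"
proof -
  let ?S = "Poly_Mapping.keys p \<union> Poly_Mapping.keys q"
  have "free_der d r = (\<Sum>w\<in>?S. scalar_elt (Poly_Mapping.lookup r w) * word_der d w)"
    if "r \<in> {p, q, p + q}" for r
    using that Poly_Mapping.keys_add[of p q] by (intro free_der_superset) auto
  then show ?thesis
    by (simp add: lookup_add scalar_elt_add distrib_right sum.distrib)
qed

lemma word_der_append:
  "word_der d (v @ w) = word_der d v * word_elt w + word_elt v * word_der d w"
proof (induction v)
  case (Cons x v)
  then show ?case
    unfolding word_elt_Cons[of x v] by (simp add: word_elt_append algebra_simps)
qed (simp add: word_elt_Nil)

lemma free_der_mult: "free_der d (p * q) = free_der d p * q + p * free_der d q"
proof (induction p rule: free_alg_induct)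
  case (single v a)
  show ?case
  proof (induction q rule: free_alg_induct)
    case (single w b)
    have "free_der d (Poly_Mapping.single v a * Poly_Mapping.single w b) =
        scalar_elt a * (scalar_elt b * (word_der d v * word_elt w + word_elt v * word_der d w))"
      by (simp add: mult_single plus_list_def free_der_single word_der_append scalar_elt_mult
          mult.assoc)
    also have "\<dots> = scalar_elt a * word_der d v * (scalar_elt b * word_elt w) +
        scalar_elt a * word_elt v * (scalar_elt b * word_der d w)"
      using scalar_elt_comm[of "word_der d v" b] scalar_elt_comm[of "word_elt v" b]
      by (metis (no_types, opaque_lifting) distrib_left mult.assoc)
    finally show ?case by (simp add: free_der_single flip: single_eq)
  qed (simp add: free_der_add algebra_simps)
qed (simp add: free_der_add algebra_simps)

lemma free_der_scalar: "free_der d (scalar_elt c) = 0"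
  by (simp add: scalar_elt_def free_der_single)

lemma free_der_diff: "free_der d (p - q) = free_der d p - free_der d q"
  using free_der_add[of d "p - q" q] by (simp add: algebra_simps)

lemma free_der_word: "free_der d (word_elt w) = word_der d w"
  by (simp add: word_elt_def free_der_single scalar_elt_1)

lemma free_der_1: "free_der d 1 = 0"
  using free_der_scalar[of d 1] by (simp add: scalar_elt_1)

lemma free_der_rel_ideal:
  assumes "\<And>q. q \<in> relators h \<Longrightarrow> free_der d q \<in> rel_ideal h" and "p \<in> rel_ideal h"
  shows "free_der d p \<in> rel_ideal h"
proof -
  have "free_der d 0 = 0"
    using free_der_diff[of d 0 0] by simp
  with assms(1) have "p \<in> rel_ideal h \<and> free_der d p \<in> rel_ideal h"
    by - (rule rel_idealD[OF assms(2),
          where P = "\<lambda>p. p \<in> rel_ideal h \<and> free_der d p \<in> rel_ideal h"],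
      simp_all add: free_der_add free_der_mult rel_ideal_closed)
  then show ?thesis ..
qed

lemma derivation_exists:
  assumes "\<And>q. q \<in> relators h \<Longrightarrow> free_der d q \<in> rel_ideal h"
  obtains D where "D \<in> extensional (carrier (C_alg h))" "derivation (C_alg h) D"
    "\<And>p. D (cls h p) = cls h (free_der d p)"
proof
  define D where "D = restrict (\<lambda>A. cls h (free_der d (SOME p. p \<in> A))) (carrier (C_alg h))"
  show D: "D (cls h p) = cls h (free_der d p)" for p
  proof -
    define q where "q = (SOME q. q \<in> cls h p)"
    have "p \<in> cls h p" using rel_ideal_closed(2) by (simp add: mem_cls)
    then have "q \<in> cls h p" unfolding q_def by (rule someI)
    then have "free_der d (q - p) \<in> rel_ideal h"
      by (intro free_der_rel_ideal[OF assms]) (auto simp: mem_cls)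
    then have "cls h (free_der d q) = cls h (free_der d p)"
      by (simp add: cls_eq free_der_diff)
    then show ?thesis by (simp add: D_def C_alg_simps q_def)
  qed
  show "D \<in> extensional (carrier (C_alg h))" by (simp add: D_def)
  show "derivation (C_alg h) D"
    by (auto simp: derivation_def C_alg_simps D free_der_add free_der_mult free_der_scalar)
qed

lemma derivation_unique:
  assumes D: "D \<in> extensional (carrier (C_alg h))" "derivation (C_alg h) D"
    and E: "E \<in> extensional (carrier (C_alg h))" "derivation (C_alg h) E"
    and eq: "\<And>g. g \<in> {GU, GR, GW} \<Longrightarrow> D (cls h (word_elt [g])) = E (cls h (word_elt [g]))"
  shows "D = E"
proof -
  have "\<exists>f. \<forall>p. D (cls h p) = cls h (f p)" if "derivation (C_alg h) D" for D
    using that unfolding derivation_def C_alg_simps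
    by (intro choice) (auto simp: Pi_iff image_iff)
  then obtain f g where f: "\<And>p. D (cls h p) = cls h (f p)" and g: "\<And>p. E (cls h p) = cls h (g p)"
    using D E by meson
  have f_add: "cls h (f (p + q)) = cls h (f p + f q)"
    and f_mult: "cls h (f (p * q)) = cls h (f p * q + p * f q)"
    and f_smult: "cls h (f (scalar_elt c * p)) = cls h (scalar_elt c * f p)" for p q c
    using D(2) unfolding derivation_def C_alg_simps by (simp_all add: C_alg_simps flip: f)
      (metis C_alg_simps(4,5,6) f rangeI)+
  have g_add: "cls h (g (p + q)) = cls h (g p + g q)"
    and g_mult: "cls h (g (p * q)) = cls h (g p * q + p * g q)"
    and g_smult: "cls h (g (scalar_elt c * p)) = cls h (scalar_elt c * g p)" for p q c
    using E(2) unfolding derivation_def C_alg_simps by (simp_all add: C_alg_simps flip: g)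
      (metis C_alg_simps(4,5,6) g rangeI)+
  define P where "P p \<longleftrightarrow> f p - g p \<in> rel_ideal h" for p
  have P_iff: "P p \<longleftrightarrow> cls h (f p) = cls h (g p)" for p
    by (simp add: P_def cls_eq)
  have P_add: "P (p + q)" if "P p" "P q" for p q
    using that rel_ideal_closed(3)[of "f p - g p" h "f q - g q"]
    unfolding P_iff f_add g_add by (simp add: cls_eq algebra_simps)
  have P_mult: "P (p * q)" if "P p" "P q" for p q
    using that rel_ideal_closed(3)[OF rel_ideal_closed(5)[of "f p - g p" h q]
        rel_ideal_closed(4)[of "f q - g q" h p]]
    unfolding P_iff f_mult g_mult by (simp add: cls_eq algebra_simps)
  have P_smult: "P (scalar_elt c * p)" if "P p" for p c
    using that rel_ideal_closed(4)[of "f p - g p" h "scalar_elt c"]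
    unfolding P_iff f_smult g_smult by (simp add: cls_eq algebra_simps)
  have f1: "f 1 \<in> rel_ideal h" and g1: "g 1 \<in> rel_ideal h"
    using f_mult[of 1 1] g_mult[of 1 1] rel_ideal_closed(6)[of "- f 1" h]
      rel_ideal_closed(6)[of "- g 1" h] by (auto simp: cls_eq)
  have P_1: "P 1" unfolding P_def by (rule rel_ideal_closed(7)[OF f1 g1])
  have P_inv: "P b" if ab: "cls h (a * b) = cls h 1" and ba: "cls h (b * a) = cls h 1"
    and "P a" for a b
  proof -
    have "cls h (f (a * b)) = cls h (f 1)" "cls h (g (a * b)) = cls h (g 1)"
      using ab f g by metis+
    then have "cls h (f (a * b)) = cls h (g (a * b))"
      using P_1 by (simp add: P_iff)
    then have "f a * b + a * f b - (g a * b + a * g b) \<in> rel_ideal h"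
      by (simp add: f_mult g_mult cls_eq)
    moreover have "(f a - g a) * b \<in> rel_ideal h"
      using \<open>P a\<close> unfolding P_def by (rule rel_ideal_closed(5))
    ultimately have "a * (f b - g b) \<in> rel_ideal h"
      using rel_ideal_closed(7) by (fastforce simp: algebra_simps)
    then have "b * (a * (f b - g b)) \<in> rel_ideal h"
      by (rule rel_ideal_closed(4))
    moreover have "(b * a - 1) * (f b - g b) \<in> rel_ideal h"
      using ba by (intro rel_ideal_closed(5)) (simp add: cls_eq)
    ultimately have "b * (a * (f b - g b)) - (b * a - 1) * (f b - g b) \<in> rel_ideal h"
      by (rule rel_ideal_closed(7))
    then show ?thesis by (simp add: P_def algebra_simps)
  qed
  have base: "P (word_elt [x])" if "x \<in> {GU, GR, GW}" for x
    using eq[OF that] by (simp add: P_iff f g)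
  have rel: "cls h (word_elt [x] * word_elt [y]) = cls h 1"
    if "(x, y) \<in> {(GW, GWinv), (GWinv, GW), (GR, GRinv), (GRinv, GR)}" for x y
    using that rel_ideal_closed(1)[of _ h]
    by (auto simp: cls_eq relators_def simp flip: word_elt_append)
  have P_gen: "P (word_elt [x])" for x
    using base[of x] P_inv[OF rel rel base, of GW GWinv] P_inv[OF rel rel base, of GR GRinv]
    by (cases x) auto
  have P_word: "P (word_elt w)" for w
  proof (induction w)
    case (Cons x w)
    then show ?case unfolding word_elt_Cons[of x w] by (intro P_mult P_gen)
  qed (simp add: word_elt_Nil P_1)
  have "P p" for p
    by (induction p rule: free_alg_induct) (auto simp: single_eq intro: P_smult P_word P_add)
  then show ?thesis
    using D(1) E(1) by (intro extensionalityI) (auto simp: C_alg_simps f g P_iff)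
qed

lemma ex1_partial_u: "\<exists>!D. is_partial_u h D"
proof (rule ex_ex1I)
  define d where "d = (\<lambda>x. case x of GU \<Rightarrow> 1 | GR \<Rightarrow> word_elt [GR]
    | GRinv \<Rightarrow> - word_elt [GRinv] | GW \<Rightarrow> 0 | GWinv \<Rightarrow> 0)"
  have "\<forall>q\<in>relators h. free_der d q \<in> {0, q, - q}"
    unfolding relators_def
    by (simp add: free_der_diff free_der_add free_der_mult free_der_scalar free_der_word
        free_der_1 d_def word_elt_Nil mult.assoc minus_mult_right[symmetric] algebra_simps
        word_elt_Cons[of _ "[_]"])
  then have "free_der d q \<in> rel_ideal h" if "q \<in> relators h" for q
    using that rel_ideal_closed(1,2,6) by (metis empty_iff insert_iff)
  then obtain D where "D \<in> extensional (carrier (C_alg h))" "derivation (C_alg h) D"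
    "\<And>p. D (cls h p) = cls h (free_der d p)"
    using derivation_exists by metis
  then show "\<exists>D. is_partial_u h D"
    by (auto simp: is_partial_u_def C_alg_simps free_der_word d_def word_elt_Nil)
next
  show "D = E" if "is_partial_u h D" "is_partial_u h E" for D E
    using that unfolding is_partial_u_def by (intro derivation_unique) auto
qed

lemma ex1_partial_v: "\<exists>!D. is_partial_v h D"
proof (rule ex_ex1I)
  define d where "d = (\<lambda>x. case x of GU \<Rightarrow> 0 | GR \<Rightarrow> 0 | GRinv \<Rightarrow> 0
    | GW \<Rightarrow> scalar_elt \<i> * word_elt [GW] | GWinv \<Rightarrow> - (scalar_elt \<i> * word_elt [GWinv]))"
  define wt :: "gen \<Rightarrow> complex" where
    "wt = (\<lambda>x. case x of GW \<Rightarrow> \<i> | GWinv \<Rightarrow> - \<i> | _ \<Rightarrow> 0)"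
  have merge: "scalar_elt a * (scalar_elt b * p) = scalar_elt (a * b) * p" for a b p
    by (simp add: scalar_elt_mult mult.assoc)
  have d_wt: "d x = scalar_elt (wt x) * word_elt [x]" for x
    by (cases x) (simp_all add: d_def wt_def scalar_elt_0 scalar_elt_minus)
  have "word_der d w = scalar_elt (sum_list (map wt w)) * word_elt w" for w
  proof (induction w)
    case (Cons x w)
    have "word_der d (x # w) = scalar_elt (wt x) * (word_elt [x] * word_elt w) +
        (word_elt [x] * scalar_elt (sum_list (map wt w))) * word_elt w"
      by (simp add: Cons d_wt mult.assoc)
    also have "\<dots> = scalar_elt (sum_list (map wt (x # w))) * word_elt (x # w)"
      unfolding word_elt_Cons[of x w] scalar_elt_comm
      by (simp add: scalar_elt_add algebra_simps)
    finally show ?case .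
  qed (simp add: scalar_elt_0)
  then have word: "free_der d (word_elt w) = scalar_elt (sum_list (map wt w)) * word_elt w" for w
    by (simp add: free_der_word)
  have "\<forall>q\<in>relators h. free_der d q \<in> {0, scalar_elt \<i> * q, scalar_elt (- \<i>) * q}"
    unfolding relators_def
    by (simp add: free_der_diff free_der_add free_der_mult free_der_scalar word
        free_der_1 wt_def scalar_elt_0 merge distrib_left right_diff_distrib mult.commute)
  then have "free_der d q \<in> rel_ideal h" if "q \<in> relators h" for q
    using that rel_ideal_closed(1,2,4) by (metis empty_iff insert_iff)
  then obtain D where "D \<in> extensional (carrier (C_alg h))" "derivation (C_alg h) D"
    "\<And>p. D (cls h p) = cls h (free_der d p)"
    using derivation_exists by metis
  then show "\<exists>D. is_partial_v h D"
    by (auto simp: is_partial_v_def C_alg_simps free_der_word d_def word_elt_Nil)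
next
  show "D = E" if "is_partial_v h D" "is_partial_v h E" for D E
    using that unfolding is_partial_v_def by (intro derivation_unique) auto
qed

section \<open>The function space and the actions\<close>

type_synonym fn = "real \<times> int \<Rightarrow> complex"

text \<open>A function is smooth if all its iterated derivatives are differentiable.\<close>

definition smooth :: "(real \<Rightarrow> complex) \<Rightarrow> bool"
  where "smooth f \<longleftrightarrow>
    (\<forall>n x. ((\<lambda>g t. vector_derivative g (at t)) ^^ n) f differentiable (at x))"

text \<open>\<open>int\<close> carries the discrete topology.\<close>

definition C0inf :: "fn set"
  where "C0inf = {\<xi>. (\<forall>k. smooth (\<lambda>x. \<xi> (x, k))) \<and> compact (closure {p. \<xi> p \<noteq> 0})}"

text \<open>Left and right generators act by operators of the same shape.\<close>

fun gen_op :: "real \<Rightarrow> real \<Rightarrow> real \<Rightarrow> int \<Rightarrow> gen \<Rightarrow> fn \<Rightarrow> fn"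
  where
    "gen_op l0 l1 e r GU \<xi> = (\<lambda>(x, k). of_real (l0 * x + l1 * of_int k) * \<xi> (x, k))"
  | "gen_op l0 l1 e r GR \<xi> = (\<lambda>(x, k). of_real (exp (l0 * x + l1 * of_int k)) * \<xi> (x, k))"
  | "gen_op l0 l1 e r GRinv \<xi> = (\<lambda>(x, k). of_real (exp (- (l0 * x + l1 * of_int k))) * \<xi> (x, k))"
  | "gen_op l0 l1 e r GW \<xi> = (\<lambda>(x, k). \<xi> (x - e, k - r))"
  | "gen_op l0 l1 e r GWinv \<xi> = (\<lambda>(x, k). \<xi> (x + e, k + r))"

text \<open>Linear extension to the free algebra of an action \<open>T\<close> of words.\<close>

definition free_act :: "(gen list \<Rightarrow> fn \<Rightarrow> fn) \<Rightarrow> free_alg \<Rightarrow> fn \<Rightarrow> fn"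
  where "free_act T p \<xi> =
    (\<lambda>z. \<Sum>w\<in>Poly_Mapping.keys p. Poly_Mapping.lookup p w * T w \<xi> z)"

text \<open>An element of the quotient acts through any of its representatives; see
  \<open>left_act_cls\<close> and \<open>right_act_cls\<close> for the independence of the choice. In a left action the
  last letter of a word is applied first, in a right action the first letter is.\<close>

definition left_act :: "real \<Rightarrow> real \<Rightarrow> real \<Rightarrow> int \<Rightarrow> free_alg set \<Rightarrow> fn \<Rightarrow> fn"
  where "left_act l0 l1 e r a \<xi> = free_act (foldr (gen_op l0 l1 e r)) (SOME p. p \<in> a) \<xi>"

definition right_act :: "real \<Rightarrow> real \<Rightarrow> real \<Rightarrow> int \<Rightarrow> fn \<Rightarrow> free_alg set \<Rightarrow> fn"
  where "right_act m0 m1 e r \<xi> a = free_act (fold (gen_op m0 m1 e r)) (SOME p. p \<in> a) \<xi>"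

lemma gen_op_linear:
  "gen_op l0 l1 e r g (\<lambda>z. c * \<xi> z + d * \<eta> z) =
    (\<lambda>z. c * gen_op l0 l1 e r g \<xi> z + d * gen_op l0 l1 e r g \<eta> z)"
  by (cases g) (auto simp: fun_eq_iff algebra_simps)

lemma foldr_gen_op_linear:
  "foldr (gen_op l0 l1 e r) w (\<lambda>z. c * \<xi> z + d * \<eta> z) =
    (\<lambda>z. c * foldr (gen_op l0 l1 e r) w \<xi> z + d * foldr (gen_op l0 l1 e r) w \<eta> z)"
  by (induction w) (simp_all add: gen_op_linear)

lemma fold_gen_op_linear:
  "fold (gen_op l0 l1 e r) w (\<lambda>z. c * \<xi> z + d * \<eta> z) =
    (\<lambda>z. c * fold (gen_op l0 l1 e r) w \<xi> z + d * fold (gen_op l0 l1 e r) w \<eta> z)"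
  using foldr_gen_op_linear[of l0 l1 e r "rev w"] by (simp add: foldr_conv_fold)

lemma free_act_superset:
  assumes "finite S" "Poly_Mapping.keys p \<subseteq> S"
  shows "free_act T p \<xi> z = (\<Sum>w\<in>S. Poly_Mapping.lookup p w * T w \<xi> z)"
  unfolding free_act_def using assms
  by (intro sum.mono_neutral_left) (auto simp: in_keys_iff)

lemma free_act_single: "free_act T (Poly_Mapping.single w c) \<xi> = (\<lambda>z. c * T w \<xi> z)"
  using free_act_superset[of "{w}" "Poly_Mapping.single w c" T \<xi>]
  by (simp add: lookup_single fun_eq_iff)

lemma free_act_add: "free_act T (p + q) \<xi> = (\<lambda>z. free_act T p \<xi> z + free_act T q \<xi> z)"
proof
  fix z
  let ?S = "Poly_Mapping.keys p \<union> Poly_Mapping.keys q"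
  have "free_act T r \<xi> z = (\<Sum>w\<in>?S. Poly_Mapping.lookup r w * T w \<xi> z)"
    if "r \<in> {p, q, p + q}" for r
    using that Poly_Mapping.keys_add[of p q] by (intro free_act_superset) auto
  then show "free_act T (p + q) \<xi> z = free_act T p \<xi> z + free_act T q \<xi> z"
    by (simp add: lookup_add distrib_right sum.distrib)
qed

lemma free_act_diff: "free_act T (p - q) \<xi> = (\<lambda>z. free_act T p \<xi> z - free_act T q \<xi> z)"
  using free_act_add[of T "p - q" q \<xi>] by (simp add: fun_eq_iff)

lemma free_act_linear:
  assumes "\<And>w c d \<xi> \<eta>. T w (\<lambda>z. c * \<xi> z + d * \<eta> z) = (\<lambda>z. c * T w \<xi> z + d * T w \<eta> z)"
  shows "free_act T p (\<lambda>z. c * \<xi> z + d * \<eta> z) =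
    (\<lambda>z. c * free_act T p \<xi> z + d * free_act T p \<eta> z)"
  by (induction p rule: free_alg_induct)
    (simp_all add: free_act_single free_act_add assms algebra_simps)

lemma free_act_mult:
  assumes "\<And>w c d \<xi> \<eta>. T w (\<lambda>z. c * \<xi> z + d * \<eta> z) = (\<lambda>z. c * T w \<xi> z + d * T w \<eta> z)"
  shows "(\<And>v w \<xi>. T (v @ w) \<xi> = T v (T w \<xi>)) \<Longrightarrow>
      free_act T (p * q) \<xi> = free_act T p (free_act T q \<xi>)"
    and "(\<And>v w \<xi>. T (v @ w) \<xi> = T w (T v \<xi>)) \<Longrightarrow>
      free_act T (p * q) \<xi> = free_act T q (free_act T p \<xi>)"
proof -
  have add: "free_act T p (\<lambda>z. \<xi> z + \<eta> z) = (\<lambda>z. free_act T p \<xi> z + free_act T p \<eta> z)"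
    and T_add: "T w (\<lambda>z. \<xi> z + \<eta> z) = (\<lambda>z. T w \<xi> z + T w \<eta> z)"
    and smult: "T w (\<lambda>z. c * \<xi> z) = (\<lambda>z. c * T w \<xi> z)" for p \<xi> \<eta> w c
    using free_act_linear[of T p 1 \<xi> 1 \<eta>, OF assms] assms[of w c \<xi> 0 \<xi>]
      assms[of w 1 \<xi> 1 \<eta>] by simp_all
  show "free_act T (p * q) \<xi> = free_act T p (free_act T q \<xi>)"
    if T: "\<And>v w \<xi>. T (v @ w) \<xi> = T v (T w \<xi>)"
  proof (induction p rule: free_alg_induct)
    case (single v a)
    show ?case
      by (induction q rule: free_alg_induct)
        (simp_all add: mult_single plus_list_def free_act_single T smult mult.assoc
          free_act_add T_add distrib_left)
  qed (simp add: free_act_add distrib_right)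
  show "free_act T (p * q) \<xi> = free_act T q (free_act T p \<xi>)"
    if T: "\<And>v w \<xi>. T (v @ w) \<xi> = T w (T v \<xi>)"
  proof (induction p rule: free_alg_induct)
    case (single v a)
    show ?case
      by (induction q rule: free_alg_induct)
        (simp_all add: mult_single plus_list_def free_act_single T smult mult_ac
          free_act_add add distrib_left)
  qed (simp add: free_act_add add distrib_right)
qed

lemma free_act_word: "free_act T (word_elt w) \<xi> = T w \<xi>"
  by (simp add: word_elt_def free_act_single)

lemma free_act_scalar_word:
  "free_act T (scalar_elt c * word_elt w) \<xi> = (\<lambda>z. c * T w \<xi> z)"
  by (simp add: free_act_single flip: single_eq)

lemma free_act_some:
  assumes "\<And>q \<xi>. q \<in> rel_ideal h \<Longrightarrow> free_act T q \<xi> = (\<lambda>z. 0)"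
  shows "free_act T (SOME q. q \<in> cls h p) \<xi> = free_act T p \<xi>"
proof -
  define q where "q = (SOME q. q \<in> cls h p)"
  have "p \<in> cls h p" using rel_ideal_closed(2) by (simp add: mem_cls)
  then have "q \<in> cls h p" unfolding q_def by (rule someI)
  then have "free_act T (q - p) \<xi> = (\<lambda>z. 0)" by (intro assms) (simp add: mem_cls)
  then show ?thesis by (simp add: free_act_diff fun_eq_iff q_def)
qed

lemma left_act_cls:
  assumes "l0 * e + l1 * of_int r = - h"
  shows "left_act l0 l1 e r (cls h p) \<xi> = free_act (foldr (gen_op l0 l1 e r)) p \<xi>"
proof -
  let ?T = "foldr (gen_op l0 l1 e r)"
  define t where "t x k = l0 * x + l1 * of_int k" for x :: real and k :: int
  have shift: "t (x - e) (k - r) = t x k + h" "t (x + e) (k + r) = t x k - h" for x k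
    using assms by (simp_all add: t_def algebra_simps)
  have op:
    "gen_op l0 l1 e r GU \<xi> (x, k) = of_real (t x k) * \<xi> (x, k)"
    "gen_op l0 l1 e r GR \<xi> (x, k) = of_real (exp (t x k)) * \<xi> (x, k)"
    "gen_op l0 l1 e r GRinv \<xi> (x, k) = of_real (exp (- t x k)) * \<xi> (x, k)"
    "gen_op l0 l1 e r GW \<xi> (x, k) = \<xi> (x - e, k - r)"
    "gen_op l0 l1 e r GWinv \<xi> (x, k) = \<xi> (x + e, k + r)" for \<xi> x k
    by (simp_all add: t_def)
  have merge: "of_real (exp a) * of_real (exp b) = (of_real (exp (a + b)) :: complex)"
    "of_real (exp a) * (of_real (exp b) * z) = of_real (exp (a + b)) * z"
    for a b and z :: complex
    by (simp_all add: exp_add)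
  note lin = free_act_linear[of ?T, OF foldr_gen_op_linear]
  note mult = free_act_mult(1)[of ?T, OF foldr_gen_op_linear]
  have rel: "\<forall>q\<in>relators h. \<forall>\<xi>. free_act ?T q \<xi> = (\<lambda>z. 0)"
    unfolding relators_def word_elt_Nil[symmetric]
    by (simp add: free_act_diff free_act_add free_act_word free_act_scalar_word fun_eq_iff
        op shift merge algebra_simps del: gen_op.simps)
  have "\<forall>\<xi>. free_act ?T q \<xi> = (\<lambda>z. 0)" if "q \<in> rel_ideal h" for q
    using that
  proof (rule rel_idealD[where P = "\<lambda>q. \<forall>\<xi>. free_act ?T q \<xi> = (\<lambda>z. 0)"])
    show "\<forall>\<xi>. free_act ?T (q * p) \<xi> = (\<lambda>z. 0)" if "\<forall>\<xi>. free_act ?T p \<xi> = (\<lambda>z. 0)" for p q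
      using that lin[of q 0 \<xi> 0 \<xi>] by (simp add: mult)
  qed (use rel in \<open>auto simp: free_act_add mult free_act_def[of _ 0]\<close>)
  then show ?thesis
    unfolding left_act_def by (intro free_act_some) auto
qed

lemma right_act_cls:
  assumes "m0 * e + m1 * of_int r = h"
  shows "right_act m0 m1 e r \<xi> (cls h p) = free_act (fold (gen_op m0 m1 e r)) p \<xi>"
proof -
  let ?T = "fold (gen_op m0 m1 e r)"
  define t where "t x k = m0 * x + m1 * of_int k" for x :: real and k :: int
  have shift: "t (x - e) (k - r) = t x k - h" "t (x + e) (k + r) = t x k + h" for x k
    using assms by (simp_all add: t_def algebra_simps)
  have op:
    "gen_op m0 m1 e r GU \<xi> (x, k) = of_real (t x k) * \<xi> (x, k)"
    "gen_op m0 m1 e r GR \<xi> (x, k) = of_real (exp (t x k)) * \<xi> (x, k)"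
    "gen_op m0 m1 e r GRinv \<xi> (x, k) = of_real (exp (- t x k)) * \<xi> (x, k)"
    "gen_op m0 m1 e r GW \<xi> (x, k) = \<xi> (x - e, k - r)"
    "gen_op m0 m1 e r GWinv \<xi> (x, k) = \<xi> (x + e, k + r)" for \<xi> x k
    by (simp_all add: t_def)
  have merge: "of_real (exp a) * of_real (exp b) = (of_real (exp (a + b)) :: complex)"
    "of_real (exp a) * (of_real (exp b) * z) = of_real (exp (a + b)) * z"
    for a b and z :: complex
    by (simp_all add: exp_add)
  note lin = free_act_linear[of ?T, OF fold_gen_op_linear]
  note mult = free_act_mult(2)[of ?T, OF fold_gen_op_linear]
  have rel: "\<forall>q\<in>relators h. \<forall>\<xi>. free_act ?T q \<xi> = (\<lambda>z. 0)"
    unfolding relators_def word_elt_Nil[symmetric]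
    by (simp add: free_act_diff free_act_add free_act_word free_act_scalar_word fun_eq_iff
        op shift merge algebra_simps del: gen_op.simps)
  have "\<forall>\<xi>. free_act ?T q \<xi> = (\<lambda>z. 0)" if "q \<in> rel_ideal h" for q
    using that
  proof (rule rel_idealD[where P = "\<lambda>q. \<forall>\<xi>. free_act ?T q \<xi> = (\<lambda>z. 0)"])
    show "\<forall>\<xi>. free_act ?T (p * q) \<xi> = (\<lambda>z. 0)" if "\<forall>\<xi>. free_act ?T p \<xi> = (\<lambda>z. 0)" for p q
      using that lin[of q 0 \<xi> 0 \<xi>] by (simp add: mult)
  qed (use rel in \<open>auto simp: free_act_add mult free_act_def[of _ 0]\<close>)
  then show ?thesis
    unfolding right_act_def by (intro free_act_some) auto
qed


section \<open>Modules and connections\<close>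

definition linear_op :: "fn set \<Rightarrow> (fn \<Rightarrow> fn) \<Rightarrow> bool"
  where "linear_op V T \<longleftrightarrow>
    T \<in> V \<rightarrow> V \<and>
    (\<forall>\<xi>\<in>V. \<forall>\<eta>\<in>V. T (\<lambda>p. \<xi> p + \<eta> p) = (\<lambda>p. T \<xi> p + T \<eta> p)) \<and>
    (\<forall>c. \<forall>\<xi>\<in>V. T (\<lambda>p. c * \<xi> p) = (\<lambda>p. c * T \<xi> p))"

definition left_module :: "(complex, 'a) module \<Rightarrow> fn set \<Rightarrow> ('a \<Rightarrow> fn \<Rightarrow> fn) \<Rightarrow> bool"
  where "left_module A V act \<longleftrightarrow>
    (\<forall>a\<in>carrier A. linear_op V (act a)) \<and>
    (\<forall>\<xi>\<in>V. act \<one>\<^bsub>A\<^esub> \<xi> = \<xi>) \<and>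
    (\<forall>a\<in>carrier A. \<forall>b\<in>carrier A. \<forall>\<xi>\<in>V.
      act (a \<otimes>\<^bsub>A\<^esub> b) \<xi> = act a (act b \<xi>) \<and>
      act (a \<oplus>\<^bsub>A\<^esub> b) \<xi> = (\<lambda>p. act a \<xi> p + act b \<xi> p)) \<and>
    (\<forall>c. \<forall>a\<in>carrier A. \<forall>\<xi>\<in>V. act (c \<odot>\<^bsub>A\<^esub> a) \<xi> = (\<lambda>p. c * act a \<xi> p))"

definition right_module :: "(complex, 'b) module \<Rightarrow> fn set \<Rightarrow> (fn \<Rightarrow> 'b \<Rightarrow> fn) \<Rightarrow> bool"
  where "right_module B V act \<longleftrightarrow>
    (\<forall>b\<in>carrier B. linear_op V (\<lambda>\<xi>. act \<xi> b)) \<and>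
    (\<forall>\<xi>\<in>V. act \<xi> \<one>\<^bsub>B\<^esub> = \<xi>) \<and>
    (\<forall>a\<in>carrier B. \<forall>b\<in>carrier B. \<forall>\<xi>\<in>V.
      act \<xi> (a \<otimes>\<^bsub>B\<^esub> b) = act (act \<xi> a) b \<and>
      act \<xi> (a \<oplus>\<^bsub>B\<^esub> b) = (\<lambda>p. act \<xi> a p + act \<xi> b p)) \<and>
    (\<forall>c. \<forall>b\<in>carrier B. \<forall>\<xi>\<in>V. act \<xi> (c \<odot>\<^bsub>B\<^esub> b) = (\<lambda>p. c * act \<xi> b p))"

definition bimodule ::
    "(complex, 'a) module \<Rightarrow> (complex, 'b) module \<Rightarrow> fn set \<Rightarrow>
     ('a \<Rightarrow> fn \<Rightarrow> fn) \<Rightarrow> (fn \<Rightarrow> 'b \<Rightarrow> fn) \<Rightarrow> bool"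
  where "bimodule A B V lact ract \<longleftrightarrow>
    left_module A V lact \<and> right_module B V ract \<and>
    (\<forall>a\<in>carrier A. \<forall>b\<in>carrier B. \<forall>\<xi>\<in>V. ract (lact a \<xi>) b = lact a (ract \<xi> b))"

definition left_connection ::
    "real \<Rightarrow> (free_alg set \<Rightarrow> fn \<Rightarrow> fn) \<Rightarrow> fn set \<Rightarrow> (fn \<Rightarrow> fn) \<Rightarrow> (fn \<Rightarrow> fn) \<Rightarrow> bool"
  where "left_connection h lact V Du Dv \<longleftrightarrow>
    (\<forall>a\<in>carrier (C_alg h). \<forall>\<xi>\<in>V.
      Du (lact a \<xi>) = (\<lambda>p. lact a (Du \<xi>) p + lact (partial_u h a) \<xi> p) \<and>
      Dv (lact a \<xi>) = (\<lambda>p. lact a (Dv \<xi>) p + lact (partial_v h a) \<xi> p))"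

definition right_connection ::
    "real \<Rightarrow> (fn \<Rightarrow> free_alg set \<Rightarrow> fn) \<Rightarrow> fn set \<Rightarrow> (fn \<Rightarrow> fn) \<Rightarrow> (fn \<Rightarrow> fn) \<Rightarrow> bool"
  where "right_connection h' ract V Du Dv \<longleftrightarrow>
    (\<forall>a\<in>carrier (C_alg h'). \<forall>\<xi>\<in>V.
      Du (ract \<xi> a) = (\<lambda>p. ract (Du \<xi>) a p + ract \<xi> (partial_u h' a) p) \<and>
      Dv (ract \<xi> a) = (\<lambda>p. ract (Dv \<xi>) a p + ract \<xi> (partial_v h' a) p))"

definition bimodule_connection ::
    "real \<Rightarrow> real \<Rightarrow> (free_alg set \<Rightarrow> fn \<Rightarrow> fn) \<Rightarrow> (fn \<Rightarrow> free_alg set \<Rightarrow> fn) \<Rightarrow> fn set \<Rightarrow>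
     (fn \<Rightarrow> fn) \<Rightarrow> (fn \<Rightarrow> fn) \<Rightarrow> bool"
  where "bimodule_connection h h' lact ract V Du Dv \<longleftrightarrow>
    linear_op V Du \<and> linear_op V Dv \<and>
    left_connection h lact V Du Dv \<and> right_connection h' ract V Du Dv"

definition nabla_u :: "real \<Rightarrow> fn \<Rightarrow> fn"
  where "nabla_u l0 \<xi> =
    (\<lambda>(x, k). of_real (1 / l0) * vector_derivative (\<lambda>t. \<xi> (t, k)) (at x))"

definition nabla_v :: "real \<Rightarrow> fn \<Rightarrow> fn"
  where "nabla_v e \<xi> = (\<lambda>(x, k). \<i> / of_real e * of_real x * \<xi> (x, k))"

end

theory Submission
  imports Defs
begin

text \<open>A linear map that satisfies the Leibniz rule for the generators \<open>U, R, W\<close> satisfies it for the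
  whole algebra, since the rule passes to products and to inverses. For \<open>\<nabla>\<^sub>u, \<nabla>\<^sub>v\<close> it holds on
  the left unconditionally; on the right, \<open>U\<close> and \<open>W\<close> applied to a bump function force
  \<open>\<mu>\<^sub>0 = \<lambda>\<^sub>0\<close> and \<open>\<epsilon>' = \<epsilon>\<close>, and these suffice. What remains is to solve the four
  equations between the parameters.\<close>

text \<open>Two ratios decide everything. Commuting d/dx past a multiplier of slope
  \<open>mu0\<close> brings out \<open>mu0\<close>, and commuting multiplication by x past a shift
  by \<open>eps'\<close> brings out \<open>eps'\<close>. The constants in \<open>nabla_u\<close> and
  \<open>nabla_v\<close> normalise these defects to 1 on the left, so on the right
  \<open>mu0 / lam0\<close> and \<open>eps' / eps\<close> must be 1 too. Concluding this needs a
  point where some function of the space is nonzero; hence an explicit bump is built, and its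
  smoothness checked against a definition by iterated derivatives. After that everything depends on
  a = \<open>lam0 * eps\<close> and two integers: h = a (r - r') / r' and h' = a (r - r') / r. So
  1/h' - 1/h = 1/a when r \<noteq> r', which is why the commutator, whose factor is i/a, can be
  written through h and h' alone.\<close>

section \<open>Calculus of smooth functions\<close>

text \<open>Derivatives are unique, so each iterate of \<open>vector_derivative\<close> that starts
  in \<open>X\<close> stays in \<open>X\<close>, and \<open>step\<close> makes it
  differentiable.\<close>

lemma smooth_coinduct:
  assumes "X f"
    and step: "\<And>f. X f \<Longrightarrow> \<exists>f'. X f' \<and> (\<forall>x. (f has_vector_derivative f' x) (at x))"
  shows "smooth f"
proof -
  let ?D = "\<lambda>g t. vector_derivative g (at t)"
  have "X ((?D ^^ n) f)" for n
  proof (induction n)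
    case (Suc n)
    then obtain f' where "X f'" "\<And>x. ((?D ^^ n) f has_vector_derivative f' x) (at x)"
      using step by meson
    then have "(?D ^^ Suc n) f = f'" by (auto intro: vector_derivative_at)
    with \<open>X f'\<close> show ?case by simp
  qed (simp add: assms(1))
  then show ?thesis
    unfolding smooth_def using step differentiableI_vector by metis
qed

lemma smoothD:
  assumes "smooth f"
  shows "smooth (\<lambda>t. vector_derivative f (at t))"
    and "(f has_vector_derivative vector_derivative f (at x)) (at x)"
proof -
  let ?D = "\<lambda>g t. vector_derivative g (at t)"
  have "(?D ^^ n) f differentiable at x" for n x
    using assms by (simp add: smooth_def)
  from this[of "Suc _"] this[of 0] show "smooth (?D f)"
    and "(f has_vector_derivative ?D f x) (at x)"
    by (auto simp: smooth_def funpow_Suc_right vector_derivative_works simp del: funpow.simps)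
qed

text \<open>The algebra generated by \<open>B\<close> and the constants. The product rule leads out
  of most natural classes of functions, but not out of the algebra they generate.\<close>

inductive smooth_alg :: "((real \<Rightarrow> complex) \<Rightarrow> bool) \<Rightarrow> (real \<Rightarrow> complex) \<Rightarrow> bool"
  for B where
  base: "B f \<Longrightarrow> smooth_alg B f"
| const: "smooth_alg B (\<lambda>x. c)"
| add: "smooth_alg B f \<Longrightarrow> smooth_alg B g \<Longrightarrow> smooth_alg B (\<lambda>x. f x + g x)"
| mult: "smooth_alg B f \<Longrightarrow> smooth_alg B g \<Longrightarrow> smooth_alg B (\<lambda>x. f x * g x)"

text \<open>Coinduction up to sums and products: derivatives of members of \<open>B\<close> need only be
  polynomial expressions in members of \<open>B\<close>.\<close>

lemma smooth_alg_smooth: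
  assumes "\<And>f. B f \<Longrightarrow> \<exists>f'. smooth_alg B f' \<and> (\<forall>x. (f has_vector_derivative f' x) (at x))"
    and "smooth_alg B f"
  shows "smooth f"
  using assms(2)
proof (rule smooth_coinduct)
  show "\<exists>f'. smooth_alg B f' \<and> (\<forall>x. (f has_vector_derivative f' x) (at x))"
    if "smooth_alg B f" for f
    using that
  proof induction
    case (const c)
    have "((\<lambda>x. c) has_vector_derivative 0) (at x)" for x :: real by simp
    then show ?case using smooth_alg.const[of B 0] by meson
  next
    case (add f g)
    then obtain f' g' where "smooth_alg B f'" "smooth_alg B g'"
      "\<And>x. (f has_vector_derivative f' x) (at x)" "\<And>x. (g has_vector_derivative g' x) (at x)"
      by auto
    then show ?case
      by (intro exI[of _ "\<lambda>x. f' x + g' x"])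
        (auto intro!: smooth_alg.add has_vector_derivative_add)
  next
    case (mult f g)
    then obtain f' g' where "smooth_alg B f'" "smooth_alg B g'"
      "\<And>x. (f has_vector_derivative f' x) (at x)" "\<And>x. (g has_vector_derivative g' x) (at x)"
      by auto
    with mult(1,2) show ?case
      by (intro exI[of _ "\<lambda>x. f x * g' x + f' x * g x"])
        (auto intro!: smooth_alg.add smooth_alg.mult has_vector_derivative_mult)
  qed (use assms(1) in blast)
qed

text \<open>With \<open>smooth\<close> itself for \<open>B\<close>, derivatives of members are
  members; this replaces any formula for the higher derivatives of a product.\<close>

lemma
  assumes "smooth f" "smooth g"
  shows smooth_add: "smooth (\<lambda>x. f x + g x)"
    and smooth_mult: "smooth (\<lambda>x. f x * g x)"
proof -
  have "\<exists>f'. smooth_alg smooth f' \<and> (\<forall>x. (f has_vector_derivative f' x) (at x))"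
    if "smooth f" for f
    using smoothD[OF that] smooth_alg.base by metis
  with assms show "smooth (\<lambda>x. f x + g x)" "smooth (\<lambda>x. f x * g x)"
    by (auto intro!: smooth_alg_smooth[of smooth] intro: smooth_alg.intros)
qed

lemma smooth_const: "smooth (\<lambda>x. c)"
  by (rule smooth_alg_smooth[of "\<lambda>_. False"]) (auto intro: smooth_alg.const)

lemma smooth_of_real: "smooth of_real"
proof (rule smooth_alg_smooth[of "\<lambda>f. f = of_real"])
  have "(of_real has_vector_derivative (1 :: complex)) (at x)" for x
    using has_vector_derivative_of_real[OF DERIV_ident] by simp
  then show "\<exists>f'. smooth_alg (\<lambda>f. f = of_real) f' \<and> (\<forall>x. (f has_vector_derivative f' x) (at x))"
    if "f = of_real" for f :: "real \<Rightarrow> complex"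
    using that smooth_alg.const[of _ 1] by blast
qed (simp add: smooth_alg.base)

lemma smooth_exp: "smooth (\<lambda>x. of_real (exp (a * x + b)))"
proof (rule smooth_alg_smooth[of "\<lambda>f. f = (\<lambda>x. of_real (exp (a * x + b)))"])
  let ?B = "\<lambda>f. f = (\<lambda>x. complex_of_real (exp (a * x + b)))"
  have "((\<lambda>x. complex_of_real (exp (a * x + b))) has_vector_derivative
      of_real a * of_real (exp (a * x + b))) (at x)" for x
    by (rule has_vector_derivative_eq_rhs[OF has_vector_derivative_of_real])
      (auto intro!: derivative_eq_intros)
  moreover have "smooth_alg ?B (\<lambda>x. of_real a * of_real (exp (a * x + b)))"
    by (rule smooth_alg.mult[OF smooth_alg.const smooth_alg.base]) simp
  ultimately show "\<exists>f'. smooth_alg ?B f' \<and> (\<forall>x. (f has_vector_derivative f' x) (at x))"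
    if "?B f" for f
    using that by meson
qed (simp add: smooth_alg.base)

text \<open>All pullbacks along one fixed affine map are treated together: the chain rule turns the
  pullback of \<open>f\<close> into a constant times the pullback of its derivative.\<close>

lemma smooth_affine: "smooth f \<Longrightarrow> smooth (\<lambda>x. f (a * x + b))"
proof (rule smooth_alg_smooth[of "\<lambda>g. \<exists>f. smooth f \<and> g = (\<lambda>x. f (a * x + b))"])
  let ?B = "\<lambda>g. \<exists>f. smooth f \<and> g = (\<lambda>x. f (a * x + b))"
  show "\<exists>g'. smooth_alg ?B g' \<and> (\<forall>x. (g has_vector_derivative g' x) (at x))" if "?B g" for g
  proof -
    from that obtain f where f: "smooth f" and g: "g = (\<lambda>x. f (a * x + b))" by blast
    define f' where "f' = (\<lambda>x. vector_derivative f (at x))"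
    have "((\<lambda>x. a * x + b) has_real_derivative a) (at x)" for x
      by (auto intro!: derivative_eq_intros)
    then have "(g has_vector_derivative of_real a * f' (a * x + b)) (at x)" for x
      using vector_diff_chain_at[of "\<lambda>x. a * x + b" a x f "f' (a * x + b)"] smoothD(2)[OF f]
      by (simp add: has_real_derivative_iff_has_vector_derivative g f'_def o_def
          scaleR_conv_of_real)
    moreover have "smooth_alg ?B (\<lambda>x. of_real a * f' (a * x + b))"
      unfolding f'_def
      by (rule smooth_alg.mult[OF smooth_alg.const smooth_alg.base]) (use smoothD(1)[OF f] in blast)
    ultimately show ?thesis by meson
  qed
qed (auto intro: smooth_alg.base)

section \<open>A smooth function vanishing on a half-line\<close>

text \<open>The substitution y = 1/x turns this into the limit of y^n / exp y at infinity.\<close>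

lemma exp_minus_inverse_flat:
  "((\<lambda>x. exp (- inverse x) * inverse x ^ n) \<longlongrightarrow> (0::real)) (at_right 0)"
  using filterlim_compose[OF tendsto_power_div_exp_0 filterlim_inverse_at_top_right]
  by (simp add: exp_minus field_simps)

text \<open>The span of these functions is closed under differentiation, also at \<open>0\<close>.\<close>

definition flat :: "nat \<Rightarrow> real \<Rightarrow> real"
  where "flat n x = (if 0 < x then exp (- inverse x) * inverse x ^ n else 0)"

lemma flat_has_real_derivative:
  "(flat n has_real_derivative flat (n + 2) x - of_nat n * flat (n + 1) x) (at x)"
proof -
  consider "x > 0" | "x < 0" | "x = 0" by linarith
  then show ?thesis
  proof cases
    case 1
    \<comment> \<open>At \<open>n = 0\<close> the exponent \<open>n - 1\<close> truncates to 0, but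
      the factor \<open>n\<close> makes both sides vanish.\<close>
    have "n * inverse x ^ (n - 1) * inverse x ^ 2 = n * inverse x ^ (n + 1)"
      by (cases n) (auto simp: power2_eq_square)
    then have "((\<lambda>x. exp (- inverse x) * inverse x ^ n) has_real_derivative
        flat (n + 2) x - of_nat n * flat (n + 1) x) (at x)"
      using 1 by (auto intro!: derivative_eq_intros simp: flat_def algebra_simps power2_eq_square)
    then show ?thesis
      by (rule has_field_derivative_transform_within_open[of _ _ _ "{0<..}"])
        (use 1 in \<open>auto simp: flat_def\<close>)
  next
    case 2
    have "((\<lambda>x. 0) has_real_derivative 0) (at x)" by simp
    then have "(flat n has_real_derivative 0) (at x)"
      by (rule has_field_derivative_transform_within_open[of _ _ _ "{..<0}"])
        (use 2 in \<open>auto simp: flat_def\<close>)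
    with 2 show ?thesis by (simp add: flat_def)
  next
    case 3
    \<comment> \<open>Dividing by y raises the exponent by one, so to the right of 0 the difference
      quotient is \<open>flat (n + 1)\<close>; hence the limit is taken at
      \<open>Suc n\<close>.\<close>
    have "((\<lambda>y. (flat n y - flat n 0) / (y - 0)) \<longlongrightarrow> 0) (at_right 0)"
      using exp_minus_inverse_flat[of "Suc n"]
      by (rule Lim_transform_eventually)
        (auto simp: flat_def eventually_at_filter divide_inverse intro!: always_eventually)
    moreover have "((\<lambda>y. (flat n y - flat n 0) / (y - 0)) \<longlongrightarrow> 0) (at_left 0)"
      by (rule Lim_transform_eventually[OF tendsto_const])
        (auto simp: flat_def eventually_at_filter intro!: always_eventually)
    ultimately have "(flat n has_real_derivative 0) (at 0)"
      unfolding has_field_derivative_iff by (simp add: filterlim_split_at)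
    with 3 show ?thesis by (simp add: flat_def)
  qed
qed

lemma smooth_flat: "smooth (\<lambda>x. of_real (flat n x))"
proof (rule smooth_alg_smooth[of "\<lambda>f. \<exists>n. f = (\<lambda>x. of_real (flat n x))"])
  let ?B = "\<lambda>f. \<exists>n. f = (\<lambda>x. complex_of_real (flat n x))"
  show "\<exists>f'. smooth_alg ?B f' \<and> (\<forall>x. (f has_vector_derivative f' x) (at x))" if "?B f" for f
  proof -
    from that obtain n where f: "f = (\<lambda>x. of_real (flat n x))" by blast
    have "(f has_vector_derivative
        of_real (flat (n + 2) x) + of_real (- of_nat n) * of_real (flat (n + 1) x)) (at x)" for x
      using has_vector_derivative_of_real[OF flat_has_real_derivative[of n x]] by (simp add: f)
    moreover have "smooth_alg ?B
        (\<lambda>x. of_real (flat (n + 2) x) + of_real (- of_nat n) * of_real (flat (n + 1) x))"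
      by (intro smooth_alg.add smooth_alg.mult smooth_alg.const) (auto intro!: smooth_alg.base)
    ultimately show ?thesis by meson
  qed
qed (auto intro: smooth_alg.base)

section \<open>Closure properties of the function space\<close>

lemma compact_closure_subset:
  fixes K :: "'a::t2_space set"
  assumes "compact K" "S \<subseteq> K"
  shows "compact (closure S)"
proof -
  have "closure S \<subseteq> K"
    using assms by (intro closure_minimal compact_imp_closed)
  then have "K \<inter> closure S = closure S" by (rule Int_absorb1)
  then show ?thesis using compact_Int_closed[OF assms(1) closed_closure[of S]] by simp
qed

lemma C0inf_compact: "\<xi> \<in> C0inf \<Longrightarrow> compact (closure {p. \<xi> p \<noteq> 0})"
  and C0inf_smooth: "\<xi> \<in> C0inf \<Longrightarrow> smooth (\<lambda>x. \<xi> (x, k))"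
  by (simp_all add: C0inf_def)

lemma C0infI:
  assumes "compact K" "{p. \<xi> p \<noteq> 0} \<subseteq> K" "\<And>k. smooth (\<lambda>x. \<xi> (x, k))"
  shows "\<xi> \<in> C0inf"
  using compact_closure_subset[OF assms(1,2)] assms(3) by (simp add: C0inf_def)

lemma C0inf_smult:
  assumes "\<xi> \<in> C0inf" "\<And>k. smooth (\<lambda>x. f (x, k))"
  shows "(\<lambda>p. f p * \<xi> p) \<in> C0inf"
proof (rule C0infI[OF C0inf_compact[OF assms(1)]])
  show "{p. f p * \<xi> p \<noteq> 0} \<subseteq> closure {p. \<xi> p \<noteq> 0}"
    using closure_subset[of "{p. \<xi> p \<noteq> 0}"] by auto
qed (intro smooth_mult assms C0inf_smooth)

lemma C0inf_add:
  assumes "\<xi> \<in> C0inf" "\<eta> \<in> C0inf"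
  shows "(\<lambda>p. \<xi> p + \<eta> p) \<in> C0inf"
proof (rule C0infI)
  show "compact (closure {p. \<xi> p \<noteq> 0} \<union> closure {p. \<eta> p \<noteq> 0})"
    by (intro compact_Un C0inf_compact assms)
  have "{p. \<xi> p + \<eta> p \<noteq> 0} \<subseteq> {p. \<xi> p \<noteq> 0} \<union> {p. \<eta> p \<noteq> 0}" by auto
  then show "{p. \<xi> p + \<eta> p \<noteq> 0} \<subseteq> closure {p. \<xi> p \<noteq> 0} \<union> closure {p. \<eta> p \<noteq> 0}"
    using Un_mono[OF closure_subset closure_subset] by (rule order_trans)
qed (intro smooth_add C0inf_smooth assms)

text \<open>The map \<open>?f\<close> undoes the translation; being continuous, it carries the
  compact support of \<open>\<xi>\<close> to a compact set that contains the support of the shifted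
  function.\<close>

lemma C0inf_shift:
  assumes "\<xi> \<in> C0inf"
  shows "(\<lambda>(x, k). \<xi> (x + a, k + m)) \<in> C0inf"
proof (rule C0infI)
  let ?f = "\<lambda>p :: real \<times> int. (fst p - a, snd p - m)"
  let ?S = "{p. (case p of (x, k) \<Rightarrow> \<xi> (x + a, k + m)) \<noteq> 0}"
  have "continuous_on UNIV ?f"
    by (intro continuous_intros continuous_on_compose2[of UNIV "\<lambda>k. k - m" _ snd]) auto
  then show "compact (?f ` closure {p. \<xi> p \<noteq> 0})"
    using C0inf_compact[OF assms] continuous_on_subset compact_continuous_image by blast
  have "?S \<subseteq> ?f ` {p. \<xi> p \<noteq> 0}"
    by (auto intro!: image_eqI[of _ _ "(_ + a, _ + m)"])
  then show "?S \<subseteq> ?f ` closure {p. \<xi> p \<noteq> 0}"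
    using image_mono[OF closure_subset] by (rule order_trans)
  show "smooth (\<lambda>x. case (x, k) of (x, k) \<Rightarrow> \<xi> (x + a, k + m))" for k
    using smooth_affine[OF C0inf_smooth[OF assms, of "k + m"], of 1 a] by simp
qed

lemma C0inf_gen_op:
  assumes "\<xi> \<in> C0inf"
  shows "gen_op l0 l1 e r g \<xi> \<in> C0inf"
proof (cases g)
  case GU
  have "smooth (\<lambda>x. of_real l0 * of_real x + of_real (l1 * of_int k))" for k
    by (intro smooth_add smooth_mult smooth_const smooth_of_real)
  then have "smooth (\<lambda>x. of_real (l0 * x + l1 * of_int k))" for k
    by simp
  with GU C0inf_smult[OF assms, of "\<lambda>(x, k). of_real (l0 * x + l1 * of_int k)"]
  show ?thesis by (simp add: case_prod_unfold)
next
  case GR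
  with C0inf_smult[OF assms, of "\<lambda>(x, k). of_real (exp (l0 * x + l1 * of_int k))"]
  show ?thesis by (simp add: case_prod_unfold smooth_exp del: of_real_exp)
next
  case GRinv
  have "smooth (\<lambda>x. of_real (exp (- (l0 * x + l1 * of_int k))))" for k
    using smooth_exp[of "- l0" "- (l1 * of_int k)"] by simp
  with GRinv C0inf_smult[OF assms, of "\<lambda>(x, k). of_real (exp (- (l0 * x + l1 * of_int k)))"]
  show ?thesis by (simp add: case_prod_unfold)
next
  case GW
  with C0inf_shift[OF assms, of "- e" "- r"] show ?thesis by simp
next
  case GWinv
  with C0inf_shift[OF assms, of e r] show ?thesis by simp
qed

text \<open>Differentiation does not enlarge the support: off that closed set a slice in x vanishes
  on an open neighbourhood, and so does its derivative.\<close>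

lemma C0inf_nabla_u:
  assumes "\<xi> \<in> C0inf"
  shows "nabla_u l0 \<xi> \<in> C0inf"
proof (rule C0infI[OF C0inf_compact[OF assms]])
  have "vector_derivative (\<lambda>t. \<xi> (t, k)) (at x) = 0" if "(x, k) \<notin> closure {p. \<xi> p \<noteq> 0}" for x k
  proof -
    let ?S = "(\<lambda>t. (t, k)) -` (- closure {p. \<xi> p \<noteq> 0})"
    have "open ?S"
      by (intro open_vimage continuous_intros) auto
    moreover have "\<xi> (t, k) = 0" if "t \<in> ?S" for t
      using that closure_subset[of "{p. \<xi> p \<noteq> 0}"] by auto
    ultimately have "((\<lambda>t. \<xi> (t, k)) has_vector_derivative 0) (at x)"
      using that has_vector_derivative_transform_within_open[of "\<lambda>_. 0" 0 x ?S "\<lambda>t. \<xi> (t, k)"]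
      by simp
    then show ?thesis by (rule vector_derivative_at)
  qed
  then show "{p. nabla_u l0 \<xi> p \<noteq> 0} \<subseteq> closure {p. \<xi> p \<noteq> 0}"
    by (force simp: nabla_u_def)
  show "smooth (\<lambda>x. nabla_u l0 \<xi> (x, k))" for k
    unfolding nabla_u_def prod.case
    by (intro smooth_mult smooth_const smoothD(1)) (rule C0inf_smooth[OF assms])
qed

lemma C0inf_nabla_v:
  assumes "\<xi> \<in> C0inf"
  shows "nabla_v e \<xi> \<in> C0inf"
proof -
  have "smooth (\<lambda>x. \<i> / of_real e * of_real x)"
    by (intro smooth_mult smooth_const smooth_of_real)
  then show ?thesis
    using C0inf_smult[OF assms, of "\<lambda>(x, k). \<i> / of_real e * of_real x"]
    by (simp add: nabla_v_def case_prod_unfold)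
qed

text \<open>The two factors vanish for x \<le> 0 and for x \<ge> 1 respectively. The integers are
  discrete, so a function living on the single slice k = 0 is admissible.\<close>

definition bump :: fn
  where "bump = (\<lambda>(x, k). if k = 0 then of_real (flat 0 x) * of_real (flat 0 (1 - x)) else 0)"

lemma bump_nonzero: "bump (1 / 2, 0) \<noteq> 0"
  by (simp add: bump_def flat_def)

lemma bump_C0inf: "bump \<in> C0inf"
proof (rule C0infI)
  show "compact ({0..1 :: real} \<times> {0 :: int})" by (intro compact_Times) auto
  show "{p. bump p \<noteq> 0} \<subseteq> {0..1} \<times> {0}"
    by (auto simp: bump_def flat_def split: if_splits)
  have "smooth (\<lambda>x. of_real (flat 0 (1 - x)))"
    using smooth_affine[OF smooth_flat, of 0 "- 1" 1] by simp
  then show "smooth (\<lambda>x. bump (x, k))" for k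
    by (cases "k = 0") (auto simp: bump_def intro!: smooth_mult smooth_flat smooth_const)
qed

section \<open>The two module structures and their compatibility\<close>

lemma foldr_gen_op_C0inf: "\<xi> \<in> C0inf \<Longrightarrow> foldr (gen_op l0 l1 e r) w \<xi> \<in> C0inf"
  by (induction w) (simp_all add: C0inf_gen_op)

lemma fold_gen_op_C0inf: "\<xi> \<in> C0inf \<Longrightarrow> fold (gen_op l0 l1 e r) w \<xi> \<in> C0inf"
  by (induction w arbitrary: \<xi>) (simp_all add: C0inf_gen_op)

lemma free_act_C0inf:
  assumes "\<And>w \<xi>. \<xi> \<in> C0inf \<Longrightarrow> T w \<xi> \<in> C0inf" and "\<xi> \<in> C0inf"
  shows "free_act T p \<xi> \<in> C0inf"
proof (induction p rule: free_alg_induct)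
  case (single w c)
  show ?case
    unfolding free_act_single
    by (rule C0inf_smult[where f = "\<lambda>_. c"]) (use assms in \<open>auto intro: smooth_const\<close>)
qed (simp add: free_act_add C0inf_add)

lemma free_act_scalar_mult: "free_act T (scalar_elt c * p) \<xi> = (\<lambda>z. c * free_act T p \<xi> z)"
proof (induction p rule: free_alg_induct)
  case (single w b)
  have "scalar_elt c * Poly_Mapping.single w b = Poly_Mapping.single w (c * b)"
    by (simp add: scalar_elt_def mult_single plus_list_def)
  then show ?case by (simp add: free_act_single mult.assoc)
qed (simp add: free_act_add distrib_left)

lemma free_act_1: "free_act T 1 \<xi> = T [] \<xi>"
  using free_act_word[of T "[]" \<xi>] by (simp add: word_elt_Nil)

lemma free_act_0: "free_act T 0 \<xi> = (\<lambda>z. 0)"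
  by (simp add: free_act_def)

lemma linear_op_free_act:
  assumes lin: "\<And>w c d \<xi> \<eta>. T w (\<lambda>z. c * \<xi> z + d * \<eta> z) = (\<lambda>z. c * T w \<xi> z + d * T w \<eta> z)"
    and "\<And>w \<xi>. \<xi> \<in> C0inf \<Longrightarrow> T w \<xi> \<in> C0inf"
  shows "linear_op C0inf (free_act T p)"
  using free_act_C0inf[of T] assms(2) free_act_linear[of T p 1 _ 1, OF lin]
    free_act_linear[of T p _ _ 0 "\<lambda>_. 0", OF lin]
  by (simp add: linear_op_def Pi_iff)

text \<open>The equation between the parameters and \<open>h\<close> lets
  \<open>left_act_cls\<close> replace the chosen representative by an arbitrary one; the module laws
  are then laws of \<open>free_act\<close>.\<close>

lemma left_module_left_act:
  assumes "l0 * e + l1 * of_int r = - h"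
  shows "left_module (C_alg h) C0inf (left_act l0 l1 e r)"
proof -
  let ?T = "foldr (gen_op l0 l1 e r)"
  have "left_act l0 l1 e r (cls h p) = free_act ?T p" for p
    using left_act_cls[OF assms] by (simp add: fun_eq_iff)
  moreover have "linear_op C0inf (free_act ?T p)" for p
    by (intro linear_op_free_act foldr_gen_op_linear foldr_gen_op_C0inf)
  ultimately show ?thesis
    using free_act_mult(1)[of ?T, OF foldr_gen_op_linear]
    by (auto simp: left_module_def C_alg_simps free_act_1 free_act_add free_act_scalar_mult)
qed

lemma right_module_right_act:
  assumes "m0 * e + m1 * of_int r = h"
  shows "right_module (C_alg h) C0inf (right_act m0 m1 e r)"
proof -
  let ?T = "fold (gen_op m0 m1 e r)"
  have "right_act m0 m1 e r \<xi> (cls h p) = free_act ?T p \<xi>" for p \<xi>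
    using right_act_cls[OF assms] by (simp add: fun_eq_iff)
  moreover have "linear_op C0inf (free_act ?T p)" for p
    by (intro linear_op_free_act fold_gen_op_linear fold_gen_op_C0inf)
  ultimately show ?thesis
    using free_act_mult(2)[of ?T, OF fold_gen_op_linear]
    by (auto simp: right_module_def C_alg_simps free_act_1 free_act_add free_act_scalar_mult)
qed

text \<open>Each hypothesis says that the linear form of one side is invariant under the translation
  of the other. So multipliers of one side commute with shifts of the other, while two multipliers
  or two shifts always commute.\<close>

lemma gen_op_commute:
  assumes "l0 * e' + l1 * of_int r' = 0" "m0 * e + m1 * of_int r = 0"
  shows "gen_op m0 m1 e' r' g' (gen_op l0 l1 e r g \<xi>) = gen_op l0 l1 e r g (gen_op m0 m1 e' r' g' \<xi>)"
proof -
  have "l0 * (x - e') + l1 * (of_int k - of_int r') = l0 * x + l1 * of_int k"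
    "l0 * (x + e') + l1 * (of_int k + of_int r') = l0 * x + l1 * of_int k"
    "m0 * (x - e) + m1 * (of_int k - of_int r) = m0 * x + m1 * of_int k"
    "m0 * (x + e) + m1 * (of_int k + of_int r) = m0 * x + m1 * of_int k" for x and k :: int
    using assms by (simp_all add: algebra_simps)
  note shift = this
  show ?thesis
    by (cases g; cases g')
      (simp_all only: gen_op.simps prod.case of_int_add of_int_diff shift split_def fst_conv snd_conv,
        auto simp: fun_eq_iff algebra_simps)
qed

lemma free_act_commute:
  assumes S: "\<And>w c d \<xi> \<eta>. S w (\<lambda>z. c * \<xi> z + d * \<eta> z) = (\<lambda>z. c * S w \<xi> z + d * S w \<eta> z)"
    and T: "\<And>w c d \<xi> \<eta>. T w (\<lambda>z. c * \<xi> z + d * \<eta> z) = (\<lambda>z. c * T w \<xi> z + d * T w \<eta> z)"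
    and ST: "\<And>v w \<xi>. S v (T w \<xi>) = T w (S v \<xi>)"
  shows "free_act S p (free_act T q \<xi>) = free_act T q (free_act S p \<xi>)"
proof (induction p rule: free_alg_induct)
  case (single v a)
  show ?case
  proof (induction q rule: free_alg_induct)
    case (single w b)
    show ?case
      using S[of v b _ 0] T[of w a _ 0] ST by (simp add: free_act_single mult.left_commute)
  next
    case (add p q)
    then show ?case
      using free_act_linear[of S _ 1 _ 1, OF S] by (simp add: free_act_add)
  qed
next
  case (add p q)
  then show ?case
    using free_act_linear[of T _ 1 _ 1, OF T] by (simp add: free_act_add)
qed

lemma bimodule_acts:
  assumes "l0 * e + l1 * of_int r = - h" "m0 * e' + m1 * of_int r' = h'"
    and "l0 * e' + l1 * of_int r' = 0" "m0 * e + m1 * of_int r = 0"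
  shows "bimodule (C_alg h) (C_alg h') C0inf (left_act l0 l1 e r) (right_act m0 m1 e' r')"
proof -
  let ?L = "foldr (gen_op l0 l1 e r)" and ?R = "fold (gen_op m0 m1 e' r')"
  \<comment> \<open>Commutation is lifted one argument at a time: to words on the left, then to
    words on the right, then bilinearly to the free algebra.\<close>
  have "gen_op m0 m1 e' r' g (?L w \<xi>) = ?L w (gen_op m0 m1 e' r' g \<xi>)" for g w \<xi>
    by (induction w) (simp_all add: gen_op_commute[OF assms(3,4)])
  then have "?R v (?L w \<xi>) = ?L w (?R v \<xi>)" for v w \<xi>
    by (induction v arbitrary: \<xi>) simp_all
  then have "free_act ?R p (free_act ?L q \<xi>) = free_act ?L q (free_act ?R p \<xi>)" for p q \<xi>
    by (intro free_act_commute fold_gen_op_linear foldr_gen_op_linear)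
  then show ?thesis
    using left_module_left_act[OF assms(1)] right_module_right_act[OF assms(2)]
    by (auto simp: bimodule_def C_alg_simps left_act_cls[OF assms(1)] right_act_cls[OF assms(2)])
qed

section \<open>The Leibniz rule from generators to the whole algebra\<close>

text \<open>A right action with its arguments swapped is a left action of the opposite algebra, and
  a derivation remains one for the opposite product. Hence one argument covers both sides;
  \<open>D\<close> and \<open>T\<close> stay abstract so that both components of the connection can
  use it.\<close>

lemma leibniz_from_generators:
  assumes M: "left_module (C_alg h) V act \<or> right_module (C_alg h) V (\<lambda>\<xi> a. act a \<xi>)"
    and D: "derivation (C_alg h) D" and T: "linear_op V T"
    and gen: "\<And>g \<xi>. g \<in> {GU, GR, GW} \<Longrightarrow> \<xi> \<in> V \<Longrightarrow> T (act (cls h (word_elt [g])) \<xi>) =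
      (\<lambda>z. act (cls h (word_elt [g])) (T \<xi>) z + act (D (cls h (word_elt [g]))) \<xi> z)"
    and a: "a \<in> carrier (C_alg h)" and \<xi>: "\<xi> \<in> V"
  shows "T (act a \<xi>) = (\<lambda>z. act a (T \<xi>) z + act (D a) \<xi> z)"
proof -
  define A where "A p = act (cls h p)" for p
  from M have lin: "linear_op V (A p)"
    and A_add: "\<xi> \<in> V \<Longrightarrow> A (p + q) \<xi> = (\<lambda>z. A p \<xi> z + A q \<xi> z)"
    and A_smult: "\<xi> \<in> V \<Longrightarrow> A (scalar_elt c * p) \<xi> = (\<lambda>z. c * A p \<xi> z)"
    and A_1: "\<xi> \<in> V \<Longrightarrow> A 1 \<xi> = \<xi>" for p q c \<xi>
    by (auto simp: A_def left_module_def right_module_def C_alg_simps)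
  from lin have A_V: "\<xi> \<in> V \<Longrightarrow> A p \<xi> \<in> V"
    and A_fadd: "\<xi> \<in> V \<Longrightarrow> \<eta> \<in> V \<Longrightarrow> A p (\<lambda>z. \<xi> z + \<eta> z) = (\<lambda>z. A p \<xi> z + A p \<eta> z)" for p \<xi> \<eta>
    by (auto simp: linear_op_def Pi_iff)
  from T have T_V: "\<xi> \<in> V \<Longrightarrow> T \<xi> \<in> V"
    and T_add: "\<xi> \<in> V \<Longrightarrow> \<eta> \<in> V \<Longrightarrow> T (\<lambda>z. \<xi> z + \<eta> z) = (\<lambda>z. T \<xi> z + T \<eta> z)"
    and T_smult: "\<xi> \<in> V \<Longrightarrow> T (\<lambda>z. c * \<xi> z) = (\<lambda>z. c * T \<xi> z)" for c \<xi> \<eta>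
    by (auto simp: linear_op_def Pi_iff)
  \<comment> \<open>\<open>m\<close> is the product for a left and the opposite product for a right module.\<close>
  obtain m where m: "m = (*) \<or> m = (\<lambda>p q. q * p)"
    and A_mult: "\<And>p q \<xi>. \<xi> \<in> V \<Longrightarrow> A (m p q) \<xi> = A p (A q \<xi>)"
    using M
  proof
    assume "left_module (C_alg h) V act"
    then show thesis
      by (intro that[of "(*)"]) (auto simp: A_def left_module_def C_alg_simps)
  next
    assume "right_module (C_alg h) V (\<lambda>\<xi> a. act a \<xi>)"
    then show thesis
      by (intro that[of "\<lambda>p q. q * p"]) (auto simp: A_def right_module_def C_alg_simps)
  qed
  have "\<forall>p. \<exists>q. D (cls h p) = cls h q"
    using D by (auto simp: derivation_def C_alg_simps Pi_iff image_iff)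
  \<comment> \<open>\<open>f\<close> picks representatives for the values of \<open>D\<close>. Its
    laws hold only modulo the ideal, so they are stated under \<open>cls\<close> and used only
    through \<open>A\<close>.\<close>
  then obtain f where f: "\<And>p. D (cls h p) = cls h (f p)" by metis
  have "cls h (f (p + q)) = cls h (f p + f q)"
    and "cls h (f (p * q)) = cls h (f p * q + p * f q)"
    and "cls h (f (scalar_elt c * p)) = cls h (scalar_elt c * f p)" for p q c
    using D unfolding derivation_def C_alg_simps by (simp_all add: C_alg_simps flip: f)
      (metis C_alg_simps(4,5,6) f rangeI)+
  then have Af: "A (f (p + q)) = A (f p + f q)" "A (f (m p q)) = A (m (f p) q + m p (f q))"
    "A (f (scalar_elt c * p)) = A (scalar_elt c * f p)" for p q c
    using m by (auto simp: A_def add.commute)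
  define P where "P p \<longleftrightarrow> (\<forall>\<xi>\<in>V. T (A p \<xi>) = (\<lambda>z. A p (T \<xi>) z + A (f p) \<xi> z))" for p
  \<comment> \<open>Differentiating 1 = 1 * 1 shows that \<open>A (f 1) \<xi>\<close> equals its own
    double.\<close>
  have f1: "A (f 1) \<xi> = (\<lambda>z. 0)" if "\<xi> \<in> V" for \<xi>
  proof -
    have "m 1 1 = 1" using m by auto
    moreover have "A (f (m 1 1)) \<xi> = (\<lambda>z. A (f 1) \<xi> z + A (f 1) \<xi> z)"
      unfolding Af(2) using that by (simp add: A_add A_mult A_1 A_V)
    ultimately have "A (f 1) \<xi> z = A (f 1) \<xi> z + A (f 1) \<xi> z" for z
      by metis
    then show ?thesis by (simp add: fun_eq_iff)
  qed
  have P_m: "P (m p q)" if "P p" "P q" for p q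
    using that by (simp add: P_def A_mult A_V T_V A_fadd Af(2) A_add add_ac)
  \<comment> \<open>Whichever product \<open>m\<close> is, \<open>p * q\<close> is either
    \<open>m p q\<close> or \<open>m q p\<close>.\<close>
  have P_mult: "P (p * q)" if "P p" "P q" for p q
    using P_m[OF that] P_m[OF that(2,1)] m by auto
  \<comment> \<open>The rule for \<open>a\<close> at the vector \<open>A b \<xi>\<close> expresses
    \<open>T \<xi>\<close> through \<open>T (A b \<xi>)\<close>. Differentiating the relation
    between \<open>a\<close> and \<open>b\<close> replaces \<open>A (f a) (A b \<xi>)\<close> by
    minus \<open>A a (A (f b) \<xi>)\<close>; then \<open>A a\<close> can be factored out and
    cancelled by applying \<open>A b\<close>.\<close>
  have P_inv: "P b" if ab: "cls h (m a b) = cls h 1" and ba: "cls h (m b a) = cls h 1" and "P a"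
    for a b
    unfolding P_def
  proof
    fix \<xi> assume \<xi>: "\<xi> \<in> V"
    have AB: "A a (A b \<xi>) = \<xi>" "A b (A a \<xi>) = \<xi>" if "\<xi> \<in> V" for \<xi>
      using that ab ba A_mult[of \<xi> a b] A_mult[of \<xi> b a] A_1[of \<xi>] by (simp_all add: A_def)
    have "A (f (m a b)) = A (f 1)"
      using ab by (metis A_def f)
    then have "A (m (f a) b + m a (f b)) \<xi> = (\<lambda>z. 0)"
      using f1[OF \<xi>] by (simp only: Af(2))
    then have E: "A (f a) (A b \<xi>) z + A a (A (f b) \<xi>) z = 0" for z
      using \<xi> by (simp add: A_add A_mult fun_eq_iff del: split_paired_All)
    have "T \<xi> = (\<lambda>z. A a (T (A b \<xi>)) z + A (f a) (A b \<xi>) z)"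
      using \<open>P a\<close> \<xi> A_V[OF \<xi>, of b] AB(1)[OF \<xi>] unfolding P_def by metis
    then have "A a (T (A b \<xi>)) = (\<lambda>z. T \<xi> z + A a (A (f b) \<xi>) z)"
      using E by (auto simp: fun_eq_iff algebra_simps add_eq_0_iff)
    also have "\<dots> = A a (\<lambda>z. A b (T \<xi>) z + A (f b) \<xi> z)"
      using \<xi> by (simp add: A_fadd A_V T_V AB)
    finally have "A b (A a (T (A b \<xi>))) = A b (A a (\<lambda>z. A b (T \<xi>) z + A (f b) \<xi> z))"
      by simp
    then have "T (A b \<xi>) = A b (A a (\<lambda>z. A b (T \<xi>) z + A (f b) \<xi> z))"
      using \<xi> by (simp add: AB A_V T_V)
    also have "\<dots> = (\<lambda>z. A b (T \<xi>) z + A (f b) \<xi> z)"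
      using \<xi> by (simp add: A_fadd AB A_V T_V)
    finally show "T (A b \<xi>) = (\<lambda>z. A b (T \<xi>) z + A (f b) \<xi> z)" .
  qed
  have base: "P (word_elt [g])" if "g \<in> {GU, GR, GW}" for g
    using gen[OF that] by (simp add: P_def A_def f)
  have "cls h (word_elt [x] * word_elt [y]) = cls h 1"
    if "(x, y) \<in> {(GW, GWinv), (GWinv, GW), (GR, GRinv), (GRinv, GR)}" for x y
    using that rel_ideal_closed(1)[of _ h]
    by (auto simp: cls_eq relators_def simp flip: word_elt_append)
  then have rel: "cls h (m (word_elt [x]) (word_elt [y])) = cls h 1"
    if "(x, y) \<in> {(GW, GWinv), (GWinv, GW), (GR, GRinv), (GRinv, GR)}" for x y
    using that m by auto
  have P_gen: "P (word_elt [x])" for x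
    using base[of x] P_inv[OF rel rel base, of GW GWinv] P_inv[OF rel rel base, of GR GRinv]
    by (cases x) auto
  have P_word: "P (word_elt w)" for w
  proof (induction w)
    case Nil
    show ?case by (simp add: word_elt_Nil P_def A_1 T_V f1)
  next
    case (Cons x w)
    then show ?case unfolding word_elt_Cons[of x w] by (intro P_mult P_gen)
  qed
  have "P p" for p
  proof (induction p rule: free_alg_induct)
    case (single w c)
    with P_word[of w] show ?case
      by (simp add: single_eq P_def A_smult Af(3) T_smult A_V T_V distrib_left)
  next
    case (add p q)
    then show ?case
      by (simp add: P_def A_add Af(1) T_add A_V T_V algebra_simps)
  qed
  then show ?thesis using a \<xi> by (auto simp: C_alg_simps P_def A_def f)
qed

section \<open>The derivations on generators\<close>

lemma partial_u_props:
  shows "derivation (C_alg h) (partial_u h)"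
    and "partial_u h (cls h (word_elt [GU])) = cls h 1"
    and "partial_u h (cls h (word_elt [GR])) = cls h (word_elt [GR])"
    and "partial_u h (cls h (word_elt [GW])) = cls h 0"
  using theI'[OF ex1_partial_u[of h]] by (auto simp: partial_u_def is_partial_u_def C_alg_simps)

lemma partial_v_props:
  shows "derivation (C_alg h) (partial_v h)"
    and "partial_v h (cls h (word_elt [GU])) = cls h 0"
    and "partial_v h (cls h (word_elt [GR])) = cls h 0"
    and "partial_v h (cls h (word_elt [GW])) = cls h (scalar_elt \<i> * word_elt [GW])"
  using theI'[OF ex1_partial_v[of h]] by (auto simp: partial_v_def is_partial_v_def C_alg_simps)

text \<open>The actions of \<open>\<partial>\<^sub>u g\<close> and \<open>\<partial>\<^sub>v g\<close>, meaningful only for the generators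
  \<open>U, R, W\<close>.\<close>

definition gen_partial_u :: "real \<Rightarrow> real \<Rightarrow> real \<Rightarrow> int \<Rightarrow> gen \<Rightarrow> fn \<Rightarrow> fn"
  where "gen_partial_u l0 l1 e r g \<xi> =
    (if g = GU then \<xi> else if g = GR then gen_op l0 l1 e r GR \<xi> else (\<lambda>z. 0))"

definition gen_partial_v :: "real \<Rightarrow> real \<Rightarrow> real \<Rightarrow> int \<Rightarrow> gen \<Rightarrow> fn \<Rightarrow> fn"
  where "gen_partial_v l0 l1 e r g \<xi> =
    (if g = GW then (\<lambda>z. \<i> * gen_op l0 l1 e r GW \<xi> z) else (\<lambda>z. 0))"

lemma left_act_gen:
  assumes "l0 * e + l1 * of_int r = - h"
  shows "left_act l0 l1 e r (cls h (word_elt [g])) \<xi> = gen_op l0 l1 e r g \<xi>"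
    and "g \<in> {GU, GR, GW} \<Longrightarrow>
      left_act l0 l1 e r (partial_u h (cls h (word_elt [g]))) \<xi> = gen_partial_u l0 l1 e r g \<xi>"
    and "g \<in> {GU, GR, GW} \<Longrightarrow>
      left_act l0 l1 e r (partial_v h (cls h (word_elt [g]))) \<xi> = gen_partial_v l0 l1 e r g \<xi>"
proof -
  note act = left_act_cls[OF assms]
  have gen: "left_act l0 l1 e r (cls h (word_elt [g])) \<xi> = gen_op l0 l1 e r g \<xi>" for g
    unfolding act free_act_word by simp
  have one: "left_act l0 l1 e r (cls h 1) \<xi> = \<xi>"
    unfolding act free_act_1 by simp
  have zero: "left_act l0 l1 e r (cls h 0) \<xi> = (\<lambda>z. 0)"
    unfolding act free_act_0 ..
  have i: "left_act l0 l1 e r (cls h (scalar_elt \<i> * word_elt [GW])) \<xi> =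
      (\<lambda>z. \<i> * gen_op l0 l1 e r GW \<xi> z)"
    unfolding act free_act_scalar_word by simp
  show "left_act l0 l1 e r (cls h (word_elt [g])) \<xi> = gen_op l0 l1 e r g \<xi>" by (rule gen)
  show "left_act l0 l1 e r (partial_u h (cls h (word_elt [g]))) \<xi> = gen_partial_u l0 l1 e r g \<xi>"
    if "g \<in> {GU, GR, GW}"
    using that by (auto simp: partial_u_props(2-) gen one zero gen_partial_u_def simp del: gen_op.simps)
  show "left_act l0 l1 e r (partial_v h (cls h (word_elt [g]))) \<xi> = gen_partial_v l0 l1 e r g \<xi>"
    if "g \<in> {GU, GR, GW}"
    using that by (auto simp: partial_v_props(2-) i zero gen_partial_v_def simp del: gen_op.simps)
qed

lemma right_act_gen:
  assumes "m0 * e + m1 * of_int r = h"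
  shows "right_act m0 m1 e r \<xi> (cls h (word_elt [g])) = gen_op m0 m1 e r g \<xi>"
    and "g \<in> {GU, GR, GW} \<Longrightarrow>
      right_act m0 m1 e r \<xi> (partial_u h (cls h (word_elt [g]))) = gen_partial_u m0 m1 e r g \<xi>"
    and "g \<in> {GU, GR, GW} \<Longrightarrow>
      right_act m0 m1 e r \<xi> (partial_v h (cls h (word_elt [g]))) = gen_partial_v m0 m1 e r g \<xi>"
proof -
  note act = right_act_cls[OF assms]
  have gen: "right_act m0 m1 e r \<xi> (cls h (word_elt [g])) = gen_op m0 m1 e r g \<xi>" for g
    unfolding act free_act_word by simp
  have one: "right_act m0 m1 e r \<xi> (cls h 1) = \<xi>"
    unfolding act free_act_1 by simp
  have zero: "right_act m0 m1 e r \<xi> (cls h 0) = (\<lambda>z. 0)"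
    unfolding act free_act_0 ..
  have i: "right_act m0 m1 e r \<xi> (cls h (scalar_elt \<i> * word_elt [GW])) =
      (\<lambda>z. \<i> * gen_op m0 m1 e r GW \<xi> z)"
    unfolding act free_act_scalar_word by simp
  show "right_act m0 m1 e r \<xi> (cls h (word_elt [g])) = gen_op m0 m1 e r g \<xi>" by (rule gen)
  show "right_act m0 m1 e r \<xi> (partial_u h (cls h (word_elt [g]))) = gen_partial_u m0 m1 e r g \<xi>"
    if "g \<in> {GU, GR, GW}"
    using that by (auto simp: partial_u_props(2-) gen one zero gen_partial_u_def simp del: gen_op.simps)
  show "right_act m0 m1 e r \<xi> (partial_v h (cls h (word_elt [g]))) = gen_partial_v m0 m1 e r g \<xi>"
    if "g \<in> {GU, GR, GW}"
    using that by (auto simp: partial_v_props(2-) i zero gen_partial_v_def simp del: gen_op.simps)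
qed

section \<open>Commuting the connection past the generators\<close>

lemma C0inf_has_vector_derivative:
  assumes "\<xi> \<in> C0inf"
  shows "((\<lambda>t. \<xi> (t, k)) has_vector_derivative vector_derivative (\<lambda>t. \<xi> (t, k)) (at x)) (at x)"
  by (rule smoothD(2)) (use assms in \<open>simp add: C0inf_def\<close>)

text \<open>The slope \<open>m0\<close> is kept apart from \<open>l0\<close> so that one formula
  serves the left action, where the ratio is 1, and the right action, where it is still to be
  determined. Translations commute with d/dx, so \<open>GW\<close> contributes no defect.\<close>

lemma nabla_u_gen_op:
  assumes \<xi>: "\<xi> \<in> C0inf" and g: "g \<in> {GU, GR, GW}"
  shows "nabla_u l0 (gen_op m0 m1 e r g \<xi>) = (\<lambda>z. gen_op m0 m1 e r g (nabla_u l0 \<xi>) z +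
    of_real (m0 / l0) * gen_partial_u m0 m1 e r g \<xi> z)"
proof -
  let ?d = "\<lambda>x k. vector_derivative (\<lambda>t. \<xi> (t, k)) (at x)"
  note deriv = C0inf_has_vector_derivative[OF \<xi>]
  have "((\<lambda>t. m0 * t + m1 * of_int k) has_real_derivative m0) (at x)" for x and k :: int
    by (auto intro!: derivative_eq_intros)
  from has_vector_derivative_mult[OF has_vector_derivative_of_real[OF this] deriv]
  have U: "vector_derivative (\<lambda>t. of_real (m0 * t + m1 * of_int k) * \<xi> (t, k)) (at x) =
      of_real (m0 * x + m1 * of_int k) * ?d x k + of_real m0 * \<xi> (x, k)" for x k
    by (intro vector_derivative_at)
  have "((\<lambda>t. exp (m0 * t + m1 * of_int k)) has_real_derivative
      m0 * exp (m0 * x + m1 * of_int k)) (at x)" for x and k :: int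
    by (auto intro!: derivative_eq_intros)
  from has_vector_derivative_mult[OF has_vector_derivative_of_real[OF this] deriv]
  have R: "vector_derivative (\<lambda>t. of_real (exp (m0 * t + m1 * of_int k)) * \<xi> (t, k)) (at x) =
      of_real (exp (m0 * x + m1 * of_int k)) * ?d x k +
      of_real (m0 * exp (m0 * x + m1 * of_int k)) * \<xi> (x, k)" for x k
    by (intro vector_derivative_at)
  have "((\<lambda>t. t - e) has_vector_derivative 1) (at x)" for x
    by (auto intro!: derivative_eq_intros)
  from vector_diff_chain_at[OF this deriv]
  have W: "vector_derivative (\<lambda>t. \<xi> (t - e, k)) (at x) = ?d (x - e) k" for x k
    by (auto simp: o_def intro: vector_derivative_at)
  from g show ?thesis
    by (auto simp: nabla_u_def gen_partial_u_def fun_eq_iff U R W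
        simp del: of_real_add of_real_exp of_real_mult)
      (simp_all add: algebra_simps add_divide_distrib)
qed

text \<open>Multipliers commute with multiplication by x, so only \<open>GW\<close> leaves a defect:
  x differs from its translate \<open>x - e'\<close> by \<open>e'\<close>.\<close>

lemma nabla_v_gen_op:
  assumes "e \<noteq> 0" and g: "g \<in> {GU, GR, GW}"
  shows "nabla_v e (gen_op m0 m1 e' r g \<xi>) = (\<lambda>z. gen_op m0 m1 e' r g (nabla_v e \<xi>) z +
    of_real (e' / e) * gen_partial_v m0 m1 e' r g \<xi> z)"
  using assms by (auto simp: nabla_v_def gen_partial_v_def fun_eq_iff field_simps)

text \<open>This is the canonical relation [d/dx, x] = 1, scaled by the two normalising
  constants.\<close>

lemma nabla_commutator:
  assumes "\<xi> \<in> C0inf"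
  shows "nabla_u l0 (nabla_v e \<xi>) (x, k) - nabla_v e (nabla_u l0 \<xi>) (x, k) =
    \<i> / of_real (l0 * e) * \<xi> (x, k)"
proof -
  have "((\<lambda>t. \<i> / of_real e * of_real t) has_vector_derivative \<i> / of_real e) (at x)"
    using has_vector_derivative_mult_right[OF has_vector_derivative_of_real[OF DERIV_ident],
        of "\<i> / of_real e"] by simp
  from has_vector_derivative_mult[OF this C0inf_has_vector_derivative[OF assms]]
  have "vector_derivative (\<lambda>t. \<i> / of_real e * of_real t * \<xi> (t, k)) (at x) =
      \<i> / of_real e * of_real x * vector_derivative (\<lambda>t. \<xi> (t, k)) (at x) +
      \<i> / of_real e * \<xi> (x, k)"
    by (intro vector_derivative_at)
  then show ?thesis by (simp add: nabla_u_def nabla_v_def algebra_simps add_divide_distrib)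
qed

lemma linear_op_nabla_u: "linear_op C0inf (nabla_u l0)"
proof -
  have "vector_derivative (\<lambda>t. \<xi> (t, k) + \<eta> (t, k)) (at x) =
      vector_derivative (\<lambda>t. \<xi> (t, k)) (at x) + vector_derivative (\<lambda>t. \<eta> (t, k)) (at x)"
    if "\<xi> \<in> C0inf" "\<eta> \<in> C0inf" for \<xi> \<eta> k x
    using that by (intro vector_derivative_at has_vector_derivative_add C0inf_has_vector_derivative)
  moreover have "vector_derivative (\<lambda>t. c * \<xi> (t, k)) (at x) =
      c * vector_derivative (\<lambda>t. \<xi> (t, k)) (at x)" if "\<xi> \<in> C0inf" for \<xi> c k x
    using that
    by (intro vector_derivative_at has_vector_derivative_mult_right C0inf_has_vector_derivative)
  ultimately show ?thesis
    using C0inf_nabla_u[of _ l0]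
    by (auto simp: linear_op_def Pi_iff nabla_u_def fun_eq_iff algebra_simps)
qed

lemma linear_op_nabla_v: "linear_op C0inf (nabla_v e)"
  using C0inf_nabla_v[of _ e]
  by (auto simp: linear_op_def Pi_iff nabla_v_def fun_eq_iff algebra_simps)

section \<open>When the pair is a bimodule connection\<close>

text \<open>An equivalence is needed: one direction extracts the constraints on the parameters, the
  other shows that every solution of them really is a connection.\<close>

lemma bimodule_connection_iff:
  assumes "l0 \<noteq> 0" "e \<noteq> 0"
    and lh: "l0 * e + l1 * of_int r = - h" and rh: "m0 * e' + m1 * of_int r' = h'"
  shows "bimodule_connection h h' (left_act l0 l1 e r) (right_act m0 m1 e' r') C0inf
      (nabla_u l0) (nabla_v e) \<longleftrightarrow> m0 = l0 \<and> e' = e"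
    (is "?conn \<longleftrightarrow> ?eq")
proof
  assume ?conn
  then have conn: "right_connection h' (right_act m0 m1 e' r') C0inf (nabla_u l0) (nabla_v e)"
    by (simp add: bimodule_connection_def)
  have gens: "gen_partial_u m0 m1 e' r' GU bump =
        right_act m0 m1 e' r' bump (partial_u h' (cls h' (word_elt [GU])))"
    "gen_partial_v m0 m1 e' r' GW bump =
        right_act m0 m1 e' r' bump (partial_v h' (cls h' (word_elt [GW])))"
    by (simp_all add: right_act_gen[OF rh])
  have "nabla_u l0 (gen_op m0 m1 e' r' GU bump) =
      (\<lambda>z. gen_op m0 m1 e' r' GU (nabla_u l0 bump) z + gen_partial_u m0 m1 e' r' GU bump z)"
    and "nabla_v e (gen_op m0 m1 e' r' GW bump) =
      (\<lambda>z. gen_op m0 m1 e' r' GW (nabla_v e bump) z + gen_partial_v m0 m1 e' r' GW bump z)"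
    unfolding right_act_gen(1)[OF rh, symmetric] gens
    using conn bump_C0inf by (auto simp: right_connection_def C_alg_simps)
  \<comment> \<open>The second evaluation point is the translate of \<open>(1 / 2, 0)\<close> that
    \<open>GW\<close> moves back to it, so both equations involve the same nonzero value of
    \<open>bump\<close>.\<close>
  from fun_cong[OF this(1), of "(1 / 2, 0)"] fun_cong[OF this(2), of "(1 / 2 + e', 0 + r')"]
  have "of_real (m0 / l0) * bump (1 / 2, 0) = bump (1 / 2, 0)"
    and "of_real (e' / e) * (\<i> * bump (1 / 2, 0)) = \<i> * bump (1 / 2, 0)"
    by (simp_all only: nabla_u_gen_op[OF bump_C0inf] nabla_v_gen_op[OF assms(2)] insert_iff simp_thms)
      (simp_all add: gen_partial_u_def gen_partial_v_def)
  then have "m0 / l0 = 1" "e' / e = 1"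
    using bump_nonzero by (auto simp flip: of_real_divide)
  with assms(1,2) show ?eq by simp
next
  assume ?eq
  have "left_connection h (left_act l0 l1 e r) C0inf (nabla_u l0) (nabla_v e)"
    unfolding left_connection_def
  proof (intro ballI conjI)
    fix a \<xi> assume a: "a \<in> carrier (C_alg h)" and \<xi>: "\<xi> \<in> C0inf"
    note leibniz = leibniz_from_generators[OF disjI1[OF left_module_left_act[OF lh]] _ _ _ a \<xi>]
    show "nabla_u l0 (left_act l0 l1 e r a \<xi>) =
        (\<lambda>p. left_act l0 l1 e r a (nabla_u l0 \<xi>) p + left_act l0 l1 e r (partial_u h a) \<xi> p)"
      by (rule leibniz[OF partial_u_props(1) linear_op_nabla_u])
        (simp only: left_act_gen[OF lh] nabla_u_gen_op div_self[OF assms(1)] of_real_1 mult_1)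
    show "nabla_v e (left_act l0 l1 e r a \<xi>) =
        (\<lambda>p. left_act l0 l1 e r a (nabla_v e \<xi>) p + left_act l0 l1 e r (partial_v h a) \<xi> p)"
      by (rule leibniz[OF partial_v_props(1) linear_op_nabla_v])
        (simp only: left_act_gen[OF lh] nabla_v_gen_op[OF assms(2)] div_self[OF assms(2)]
          of_real_1 mult_1)
  qed
  moreover have "right_connection h' (right_act m0 m1 e' r') C0inf (nabla_u l0) (nabla_v e)"
    unfolding right_connection_def
  proof (intro ballI conjI)
    fix a \<xi> assume a: "a \<in> carrier (C_alg h')" and \<xi>: "\<xi> \<in> C0inf"
    \<comment> \<open>After \<open>m0\<close> and \<open>e'\<close> are replaced by
      \<open>l0\<close> and \<open>e\<close>, the defect ratios read \<open>l0 / l0\<close> and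
      \<open>e / e\<close> and cancel syntactically.\<close>
    have rh': "l0 * e + m1 * of_int r' = h'"
      using rh \<open>?eq\<close> by simp
    note leibniz = leibniz_from_generators[OF disjI2[OF right_module_right_act[OF rh']] _ _ _ a \<xi>]
    have "nabla_u l0 (right_act l0 m1 e r' \<xi> a) =
        (\<lambda>p. right_act l0 m1 e r' (nabla_u l0 \<xi>) a p + right_act l0 m1 e r' \<xi> (partial_u h' a) p)"
      by (rule leibniz[OF partial_u_props(1) linear_op_nabla_u])
        (simp only: right_act_gen[OF rh'] nabla_u_gen_op div_self[OF assms(1)] of_real_1 mult_1)
    moreover have "nabla_v e (right_act l0 m1 e r' \<xi> a) =
        (\<lambda>p. right_act l0 m1 e r' (nabla_v e \<xi>) a p + right_act l0 m1 e r' \<xi> (partial_v h' a) p)"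
      by (rule leibniz[OF partial_v_props(1) linear_op_nabla_v])
        (simp only: right_act_gen[OF rh'] nabla_v_gen_op[OF assms(2)] div_self[OF assms(2)]
          of_real_1 mult_1)
    ultimately show "nabla_u l0 (right_act m0 m1 e' r' \<xi> a) =
        (\<lambda>p. right_act m0 m1 e' r' (nabla_u l0 \<xi>) a p + right_act m0 m1 e' r' \<xi> (partial_u h' a) p)"
      "nabla_v e (right_act m0 m1 e' r' \<xi> a) =
        (\<lambda>p. right_act m0 m1 e' r' (nabla_v e \<xi>) a p + right_act m0 m1 e' r' \<xi> (partial_v h' a) p)"
      using \<open>?eq\<close> by simp_all
  qed
  ultimately show ?conn
    by (simp add: bimodule_connection_def linear_op_nabla_u linear_op_nabla_v)
qed

section \<open>Solving for the parameters\<close>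

text \<open>With a = \<open>l0 * e\<close> nonzero, the last two equations read l1 r' = - a = m1 r,
  which makes both integers nonzero and determines \<open>l1\<close> and \<open>m1\<close>; the
  first two then merely compute \<open>h\<close> and \<open>h'\<close>. In terms of a, r and r' the
  later claims become field identities.\<close>

lemma parameters_solution:
  fixes h h' l0 l1 m1 e :: real and r r' :: int
  assumes "l0 \<noteq> 0" "e \<noteq> 0"
    and eqs: "l0 * e + l1 * of_int r = - h" "l0 * e + m1 * of_int r' = h'"
      "l0 * e + l1 * of_int r' = 0" "l0 * e + m1 * of_int r = 0"
  shows "r \<noteq> 0" "r' \<noteq> 0" "h * of_int r' = h' * of_int r"
    and "h = l0 * e * of_int (r - r') / of_int r'" "h' = l0 * e * of_int (r - r') / of_int r"
    and "l1 = - (l0 * e / of_int r')" "m1 = - (l0 * e / of_int r)"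
proof -
  show r: "r \<noteq> 0" "r' \<noteq> 0" using assms by auto
  then show l1: "l1 = - (l0 * e / of_int r')" and m1: "m1 = - (l0 * e / of_int r)"
    using eqs by (simp_all add: field_simps add_eq_0_iff)
  show h: "h = l0 * e * of_int (r - r') / of_int r'" and h': "h' = l0 * e * of_int (r - r') / of_int r"
    using r eqs(1,2) by (simp_all add: l1 m1 field_simps)
  show "h * of_int r' = h' * of_int r"
    using r by (simp add: h h')
qed

theorem proposition5p3:
  fixes h h' lam0 lam1 mu0 mu1 eps eps' :: real and r r' :: int
  shows
    "(lam0 \<noteq> 0 \<and> eps \<noteq> 0 \<and>
      lam0 * eps + lam1 * of_int r = - h \<and> mu0 * eps' + mu1 * of_int r' = h' \<and>
      lam0 * eps' + lam1 * of_int r' = 0 \<and> mu0 * eps + mu1 * of_int r = 0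
      \<longrightarrow>
      bimodule (C_alg h) (C_alg h') C0inf (left_act lam0 lam1 eps r) (right_act mu0 mu1 eps' r') \<and>
      (bimodule_connection h h' (left_act lam0 lam1 eps r) (right_act mu0 mu1 eps' r') C0inf
         (nabla_u lam0) (nabla_v eps)
       \<longrightarrow>
       (h = h' \<longrightarrow> h = 0 \<and> h' = 0) \<and>
       (h \<noteq> h' \<longrightarrow>
          h \<noteq> 0 \<and> h' \<noteq> 0 \<and> h / h' \<in> \<rat> \<and>
          eps = eps' \<and> r \<noteq> 0 \<and> r' \<noteq> 0 \<and> r \<noteq> r' \<and> of_int r / of_int r' = h / h' \<and>
          lam0 = mu0 \<and> mu0 = h * of_int r' / (eps * of_int (r - r')) \<and>
          lam1 = - (h / of_int (r - r')) \<and>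
          mu1 = - (h' / of_int (r - r')) \<and>
          (\<forall>\<xi>\<in>C0inf. \<forall>x k.
             nabla_u lam0 (nabla_v eps \<xi>) (x, k) - nabla_v eps (nabla_u lam0 \<xi>) (x, k) =
             \<i> * of_real ((h - h') / (h * h')) * \<xi> (x, k)))))
     \<and>
     (h \<noteq> h' \<and> eps \<noteq> 0 \<and> eps = eps' \<and> r \<noteq> 0 \<and> r' \<noteq> 0 \<and> of_int r / of_int r' = h / h' \<and>
      lam0 = mu0 \<and> mu0 = h * of_int r' / (eps * of_int (r - r')) \<and>
      lam1 = - (h / of_int (r - r')) \<and>
      mu1 = - (h' / of_int (r - r'))
      \<longrightarrow>
      lam0 \<noteq> 0 \<and>
      lam0 * eps + lam1 * of_int r = - h \<and> mu0 * eps' + mu1 * of_int r' = h' \<and>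
      lam0 * eps' + lam1 * of_int r' = 0 \<and> mu0 * eps + mu1 * of_int r = 0 \<and>
      bimodule_connection h h' (left_act lam0 lam1 eps r) (right_act mu0 mu1 eps' r') C0inf
        (nabla_u lam0) (nabla_v eps))"
    (is "(?hyp \<longrightarrow> ?bimod \<and> (?conn \<longrightarrow> ?res)) \<and> (?par \<longrightarrow> ?conv)")
proof (rule conjI; rule impI)
  assume ?hyp
  then have nz: "lam0 \<noteq> 0" "eps \<noteq> 0"
    and eqs: "lam0 * eps + lam1 * of_int r = - h" "mu0 * eps' + mu1 * of_int r' = h'"
      "lam0 * eps' + lam1 * of_int r' = 0" "mu0 * eps + mu1 * of_int r = 0"
    by auto
  show "?bimod \<and> (?conn \<longrightarrow> ?res)"
  proof (rule conjI[OF bimodule_acts[OF eqs] impI])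
    assume ?conn
    then have eq: "mu0 = lam0" "eps' = eps"
      using bimodule_connection_iff[OF nz eqs(1,2)] by auto
    note sol = parameters_solution[OF nz eqs[unfolded eq]]
    show ?res
    proof (intro conjI impI)
      assume "h = h'"
      \<comment> \<open>When \<open>h = h'\<close>, proportionality reads h r' = h r. In the case r
        = r' the formula for \<open>h\<close> contains the factor r - r' = 0.\<close>
      with sol(3) have "h = 0 \<or> r = r'" by auto
      with \<open>h = h'\<close> sol(4) show "h = 0" "h' = 0" by auto
    next
      assume ne: "h \<noteq> h'"
      with sol(4,5) show rr: "r \<noteq> r'" by auto
      with nz sol(1,2) have h0: "h \<noteq> 0" "h' \<noteq> 0" by (simp_all add: sol(4,5))
      then show "h \<noteq> 0" "h' \<noteq> 0" by simp_all
      show quot: "of_int r / of_int r' = h / h'"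
        using sol(2,3) h0 by (simp add: field_simps)
      show "h / h' \<in> \<rat>" by (simp flip: quot)
      show "eps = eps'" "lam0 = mu0" "r \<noteq> 0" "r' \<noteq> 0" using eq sol by simp_all
      show "mu0 = h * of_int r' / (eps * of_int (r - r'))"
        using rr nz sol(2) by (simp add: eq sol(4))
      show "lam1 = - (h / of_int (r - r'))" "mu1 = - (h' / of_int (r - r'))"
        using rr sol(1,2) by (simp_all add: sol(4,5,6,7))
      define a d where "a = lam0 * eps" and "d = real_of_int (r - r')"
      have "a \<noteq> 0" "d \<noteq> 0" using nz rr by (simp_all add: a_def d_def)
      have h: "h = a * d / of_int r'" and h': "h' = a * d / of_int r"
        using sol(4,5) by (simp_all add: a_def d_def)
      \<comment> \<open>Since \<open>d\<close> is itself r - r', the difference is a d^2 / (r r') =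
        h h' / a. Its quotient by h h' is therefore 1/a, the factor produced by
        \<open>nabla_commutator\<close>.\<close>
      have "h - h' = a * d * (of_int r - of_int r') / (of_int r * of_int r')"
        using sol(1,2) by (simp add: h h' field_simps)
      also have "\<dots> = h * h' / a"
        using \<open>a \<noteq> 0\<close> by (simp add: h h' d_def ac_simps)
      finally have "(h - h') / (h * h') = 1 / (lam0 * eps)"
        using h0 by (simp add: a_def)
      then show "\<forall>\<xi>\<in>C0inf. \<forall>x k.
          nabla_u lam0 (nabla_v eps \<xi>) (x, k) - nabla_v eps (nabla_u lam0 \<xi>) (x, k) =
          \<i> * of_real ((h - h') / (h * h')) * \<xi> (x, k)"
        using nabla_commutator[of _ lam0 eps] by (simp add: nabla_commutator)
    qed
  qed
next
  assume p: ?par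
  \<comment> \<open>Division by zero yields 0, so if either number vanished the quotient
    \<open>h / h'\<close> would be 0, whereas the quotient of the nonzero integers is not.\<close>
  then have "h \<noteq> 0" "h' \<noteq> 0" by auto
  from p have "of_int r / of_int r' = h / h'" "of_int r' \<noteq> (0 :: real)" by auto
  with \<open>h' \<noteq> 0\<close> have hr: "h * of_int r' = h' * of_int r" by (simp add: frac_eq_eq mult.commute)
  have rr: "r \<noteq> r'" using p hr by auto
  with p \<open>h \<noteq> 0\<close> have nz: "lam0 \<noteq> 0" "eps \<noteq> 0" by auto
  define d where "d = real_of_int (r - r')"
  have d: "d \<noteq> 0" using rr by (simp add: d_def)
  from p have lam1: "lam1 = - (h / d)" and mu1: "mu1 = - (h' / d)"
    and eq: "eps' = eps" "mu0 = lam0" and lam0: "lam0 = h * of_int r' / (eps * d)"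
    unfolding d_def by blast+
  have le: "lam0 * eps = h * of_int r' / d"
    using nz by (simp add: lam0)
  \<comment> \<open>All four equations are instances, with \<open>h\<close> or \<open>h'\<close> for
    \<open>c\<close> and \<open>r\<close> or \<open>r'\<close> for \<open>s\<close>; by
    \<open>hr\<close> the numerators become - h d, h' d, 0 and 0.\<close>
  have diff: "lam0 * eps + - (c / d) * of_int s = (h * of_int r' - c * of_int s) / d" for c s
    by (simp add: le diff_divide_distrib)
  have "h * of_int r' - h * of_int r = - h * d" "h * of_int r' - h' * of_int r' = h' * d"
    using hr by (simp_all add: d_def algebra_simps)
  then have lh: "lam0 * eps + lam1 * of_int r = - h" and rh: "mu0 * eps' + mu1 * of_int r' = h'"
    using d unfolding lam1 mu1 eq diff by simp_all
  have "lam0 * eps' + lam1 * of_int r' = 0" "mu0 * eps + mu1 * of_int r = 0"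
    unfolding lam1 mu1 eq diff by (simp_all add: hr)
  moreover have "bimodule_connection h h' (left_act lam0 lam1 eps r) (right_act mu0 mu1 eps' r') C0inf
      (nabla_u lam0) (nabla_v eps)"
    using bimodule_connection_iff[OF nz lh rh] p by auto
  ultimately show ?conv using nz lh rh by simp
qed

end
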